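(* Let $\Omega\subset\mathbb{R}^n$ be an open set, let $1<p<\infty$, and let $\mathscr{A}=(a^{hk})$ be an $n\times n$ matrix whose entries are complex measures $a^{hk}\in (C_0(\Omega))^*$. Assume that the matrix $\operatorname{Im}\mathscr{A}$ is symmetric, i.e. $\operatorname{Im}\mathscr{A}^t=\operatorname{Im}\mathscr{A}$. Then the form $$\mathscr{L}(u,v)=\int_\Omega\langle \mathscr{A}\nabla u,\nabla v\rangle ,\qquad u,v\in C_0^1(\Omega),$$ is $L^p$-dissipative if and only if $$|p-2|\,|\langle \operatorname{Im}\mathscr{A}\,\xi,\xi\rangle|\leq 2\sqrt{p-1}\,\langle \operatorname{Re}\mathscr{A}\,\xi,\xi\rangle$$ for any $\xi\in\mathbb{R}^n$, where $|\cdot|$ on the left denotes the total variation of the measure $\langle \operatorname{Im}\mathscr{A}\,\xi,\xi\rangle$ and the inequality is an inequality between measures on $\Omega$ (i.e. it holds after integration against every nonnegative function in $C_0(\Omega)$).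
   Context: $C_0(\Omega)$ is the space of complex valued continuous functions with compact support in $\Omega$; $C_0^1(\Omega)$ is the set of functions in $C_0(\Omega)$ with continuous first order partial derivatives; $(C_0(\Omega))^*$ is the dual of $C_0(\Omega)$ (complex measures on $\Omega$). $\langle\cdot,\cdot\rangle$ is the inner product in $\mathbb{C}^n$ or $\mathbb{C}$ (conjugate-linear in the second entry). $\operatorname{Re}\mathscr{A}$ and $\operatorname{Im}\mathscr{A}$ are the matrices of real and imaginary parts of the entries, and $\mathscr{A}^t$ is the transpose. The integral $\int_\Omega\langle \mathscr{A}\nabla u,\nabla v\rangle$ means $\sum_{h,k}\int_\Omega \partial_k u\,\overline{\partial_h v}\,da^{hk}$. Definition. With $p'=p/(p-1)$, the form $\mathscr{L}$ is called $L^p$-dissipative if for all $u\in C_0^1(\Omega)$: $\operatorname{Re}\mathscr{L}(u,|u|^{p-2}u)\geq 0$ if $p\geq 2$; $\operatorname{Re}\mathscr{L}(|u|^{p'-2}u,u)\geq 0$ if $1<p<2$. (For $q\ge 2$ and $u\in C_0^1(\Omega)$ one has $|u|^{q-2}u\in C_0^1(\Omega)$.) *)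

theory Defs
  imports "HOL-Analysis.Analysis"
begin

text \<open>
  A function on \<open>\<Omega>\<close> with compact support in \<open>\<Omega>\<close> is represented by its extension by zero to the
  whole space.
\<close>

definition C0 :: "(real^'n) set \<Rightarrow> (real^'n \<Rightarrow> complex) set" where
  "C0 \<Omega> = {f. continuous_on \<Omega> f \<and> compact (closure {x. f x \<noteq> 0}) \<and> closure {x. f x \<noteq> 0} \<subseteq> \<Omega>}"

definition partial :: "'n \<Rightarrow> (real^'n \<Rightarrow> complex) \<Rightarrow> real^'n \<Rightarrow> complex" where
  "partial k f x = vector_derivative (\<lambda>t. f (x + t *\<^sub>R axis k 1)) (at 0)"

definition C01 :: "(real^'n) set \<Rightarrow> (real^'n \<Rightarrow> complex) set" where
  "C01 \<Omega> = {f \<in> C0 \<Omega>. \<forall>k. (\<forall>x\<in>\<Omega>. (\<lambda>t. f (x + t *\<^sub>R axis k 1)) differentiable (at 0)) \<and>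
                            continuous_on \<Omega> (partial k f)}"

text \<open>
  Complex measures on \<open>\<Omega>\<close> are elements of the dual of \<open>C0 \<Omega>\<close> for its usual inductive limit
  topology, i.e. linear functionals that are bounded in the supremum norm on the functions supported
  in any fixed compact subset of \<open>\<Omega>\<close>. They need not have finite total mass (for instance, Lebesgue
  measure on an unbounded \<open>\<Omega>\<close> is included), and \<open>\<mu> f\<close> is the integral of \<open>f\<close> with respect to \<open>\<mu>\<close>.
  Only the values of a functional on \<open>C0 \<Omega>\<close> are meaningful.
\<close>

type_synonym 'n functional = "(real^'n \<Rightarrow> complex) \<Rightarrow> complex"

definition C0_dual :: "(real^'n) set \<Rightarrow> 'n functional set" where
  "C0_dual \<Omega> = {\<mu>.
     (\<forall>f\<in>C0 \<Omega>. \<forall>g\<in>C0 \<Omega>. \<mu> (\<lambda>x. f x + g x) = \<mu> f + \<mu> g) \<and>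
     (\<forall>f\<in>C0 \<Omega>. \<forall>c. \<mu> (\<lambda>x. c * f x) = c * \<mu> f) \<and>
     (\<forall>K. compact K \<and> K \<subseteq> \<Omega> \<longrightarrow>
        (\<exists>C. \<forall>f\<in>C0 \<Omega>. {x. f x \<noteq> 0} \<subseteq> K \<longrightarrow> cmod (\<mu> f) \<le> C * (SUP x. cmod (f x))))}"

text \<open>
  The complex conjugate of a measure \<open>\<mu>\<close> integrates \<open>f\<close> to the conjugate of the \<open>\<mu>\<close>-integral of the
  conjugate of \<open>f\<close>; real and imaginary parts of measures are taken with respect to this conjugation.
\<close>

definition meas_cnj :: "'n functional \<Rightarrow> 'n functional" where
  "meas_cnj \<mu> f = cnj (\<mu> (\<lambda>x. cnj (f x)))"

definition meas_Re :: "'n functional \<Rightarrow> 'n functional" where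
  "meas_Re \<mu> f = (\<mu> f + meas_cnj \<mu> f) / 2"

definition meas_Im :: "'n functional \<Rightarrow> 'n functional" where
  "meas_Im \<mu> f = (\<mu> f - meas_cnj \<mu> f) / (2 * \<i>)"

definition meas_eq :: "(real^'n) set \<Rightarrow> 'n functional \<Rightarrow> 'n functional \<Rightarrow> bool" where
  "meas_eq \<Omega> \<mu> \<nu> \<longleftrightarrow> (\<forall>f\<in>C0 \<Omega>. \<mu> f = \<nu> f)"

text \<open>
  The total variation \<open>|\<mu>|\<close>, integrated against a nonnegative function \<open>\<phi>\<close> in \<open>C0 \<Omega>\<close>. The supremum
  is over a nonempty bounded set when \<open>\<mu>\<close> is in \<open>C0_dual \<Omega>\<close>, since every competitor \<open>g\<close> is supported
  in the support of \<open>\<phi>\<close>.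
\<close>

definition total_variation ::
  "(real^'n) set \<Rightarrow> 'n functional \<Rightarrow> (real^'n \<Rightarrow> real) \<Rightarrow> real" where
  "total_variation \<Omega> \<mu> \<phi> = (SUP g\<in>{g \<in> C0 \<Omega>. \<forall>x. cmod (g x) \<le> \<phi> x}. cmod (\<mu> g))"

definition mat_Re :: "'n functional^'n^'n \<Rightarrow> 'n functional^'n^'n" where
  "mat_Re A = (\<chi> h k. meas_Re (A $ h $ k))"

definition mat_Im :: "'n functional^'n^'n \<Rightarrow> 'n functional^'n^'n" where
  "mat_Im A = (\<chi> h k. meas_Im (A $ h $ k))"

text \<open>The scalar measure \<open>\<langle>M \<xi>, \<xi>\<rangle>\<close> for a matrix \<open>M\<close> of measures and a constant real vector \<open>\<xi>\<close>.\<close>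

definition quad :: "'n functional^'n^'n \<Rightarrow> real^'n \<Rightarrow> 'n functional" where
  "quad M \<xi> f = (\<Sum>h\<in>UNIV. \<Sum>k\<in>UNIV. complex_of_real (\<xi> $ k * \<xi> $ h) * (M $ h $ k) f)"

definition sesq_form ::
  "'n functional^'n^'n \<Rightarrow> (real^'n \<Rightarrow> complex) \<Rightarrow> (real^'n \<Rightarrow> complex) \<Rightarrow> complex" where
  "sesq_form A u v =
     (\<Sum>h\<in>UNIV. \<Sum>k\<in>UNIV. (A $ h $ k) (\<lambda>x. partial k u x * cnj (partial h v x)))"

text \<open>
  The function \<open>|u|^(q-2) u\<close>. At zeros of \<open>u\<close> its value is \<open>0\<close>, also for \<open>q = 2\<close>, where
  \<open>0 powr 0 = 0\<close> is harmless here.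
\<close>

definition pow_mult :: "real \<Rightarrow> (real^'n \<Rightarrow> complex) \<Rightarrow> real^'n \<Rightarrow> complex" where
  "pow_mult q u x = complex_of_real (cmod (u x) powr (q - 2)) * u x"

definition Lp_dissipative ::
  "(real^'n) set \<Rightarrow> real \<Rightarrow>
   ((real^'n \<Rightarrow> complex) \<Rightarrow> (real^'n \<Rightarrow> complex) \<Rightarrow> complex) \<Rightarrow> bool" where
  "Lp_dissipative \<Omega> p L \<longleftrightarrow>
     (\<forall>u\<in>C01 \<Omega>. if p \<ge> 2 then Re (L u (pow_mult p u)) \<ge> 0
                 else Re (L (pow_mult (p / (p - 1)) u) u) \<ge> 0)"

end

theory Submission
  imports Defs
begin

text \<open>
  Write \<open>q = p\<close> if \<open>p \<ge> 2\<close> and \<open>q = p / (p - 1)\<close> otherwise; the second case is the first one for the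
  adjoint matrix, so only \<open>L(u, |u|^(q-2) u)\<close> matters. At a point where \<open>u \<noteq> 0\<close> put
  \<open>(cnj u / |u|) \<nabla>u = X + i Y\<close>. Since \<open>Im A\<close> is symmetric, the density of \<open>Re L(u, |u|^(q-2) u)\<close> is
  \<open>|u|^(q-2) ((q-1) \<langle>Re A X, X\<rangle> + \<langle>Re A Y, Y\<rangle> - (q-2) \<langle>Im A X, Y\<rangle>)\<close>, and polarisation with
  \<open>sqrt (q-1) X \<plusminus> Y\<close> shows that it is nonnegative under the algebraic condition. That condition only
  concerns constant vectors \<open>\<xi>\<close>; a partition of unity, together with the continuity of the functionals
  on functions supported in a fixed compact set, extends it to fields, and no measure theory is needed.

  Conversely, test with \<open>u = w exp (\<kappa> sin (N^2 \<langle>\<xi>, x\<rangle> + \<theta>) / N)\<close>, where \<open>\<kappa> = 1 \<plusminus> i sqrt (q-1)\<close>. Then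
  \<open>|u| \<approx> |w|\<close> while \<open>\<nabla>u \<approx> N \<kappa> u cos (N^2 \<langle>\<xi>, x\<rangle> + \<theta>) \<xi>\<close>. After division by \<open>N^2\<close>, adding the
  inequalities for \<open>\<theta> = 0\<close> and \<open>\<theta> = \<pi>/2\<close> removes the oscillation because \<open>cos^2 + sin^2 = 1\<close>, and
  \<open>N \<rightarrow> \<infinity>\<close> gives the condition tested against \<open>|w|^q\<close>; such functions are dense.
\<close>

section \<open>Functions with compact support and functionals on them\<close>

text \<open>\<open>C0\<close> demands continuity on \<Omega> only. Since \<Omega> and the open
  complement of the support, where \<open>f\<close> vanishes, cover the whole space, continuity
  becomes global.\<close>

lemma C0_continuous:
  assumes "open \<Omega>" "f \<in> C0 \<Omega>"
  shows "continuous_on UNIV f"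
proof -
  let ?S = "closure {x. f x \<noteq> 0}"
  have f: "continuous_on \<Omega> f" "?S \<subseteq> \<Omega>" using assms by (auto simp: C0_def)
  have "f x = 0" if "x \<in> - ?S" for x
    using that closure_subset[of "{x. f x \<noteq> 0}"] by blast
  then have "continuous_on (- ?S) f"
    by (metis (no_types, lifting) continuous_on_cong continuous_on_const)
  moreover have "\<Omega> \<union> - ?S = UNIV" using f by auto
  ultimately show ?thesis
    using continuous_on_open_Un[OF assms(1) _ f(1), of "- ?S"] by auto
qed

lemma C0I:
  assumes "continuous_on UNIV f" "compact K" "K \<subseteq> \<Omega>" "\<And>x. f x \<noteq> 0 \<Longrightarrow> x \<in> K"
  shows "f \<in> C0 \<Omega>"
proof -
  have "closure {x. f x \<noteq> 0} \<subseteq> K"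
    using assms by (intro closure_minimal) (auto simp: compact_imp_closed)
  moreover from this have "compact (closure {x. f x \<noteq> 0})"
    using assms(2) closed_closure compact_closure bounded_subset compact_imp_bounded
    by (metis closure_subset subset_trans)
  ultimately show ?thesis using assms(1,3)
    by (auto simp: C0_def intro: continuous_on_subset)
qed

lemma C0_supportE:
  assumes "f \<in> C0 \<Omega>"
  obtains K where "compact K" "K \<subseteq> \<Omega>" "\<And>x. f x \<noteq> 0 \<Longrightarrow> x \<in> K"
proof (rule that[of "closure {x. f x \<noteq> 0}"])
  show "x \<in> closure {x. f x \<noteq> 0}" if "f x \<noteq> 0" for x
    by (rule subsetD[OF closure_subset]) (use that in simp)
qed (use assms in \<open>auto simp: C0_def\<close>)

lemma C0_bounded:
  assumes "open \<Omega>" "f \<in> C0 \<Omega>"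
  obtains B where "B > 0" "\<And>x. cmod (f x) \<le> B"
proof -
  obtain K where K: "compact K" "K \<subseteq> \<Omega>" "\<And>x. f x \<noteq> 0 \<Longrightarrow> x \<in> K"
    using assms(2) by (rule C0_supportE) blast
  have "bounded (f ` K)"
    by (intro compact_imp_bounded compact_continuous_image K(1)
          continuous_on_subset[OF C0_continuous[OF assms]]) auto
  then obtain B where B: "B > 0" "\<And>x. x \<in> K \<Longrightarrow> cmod (f x) \<le> B"
    unfolding bounded_pos by auto
  have "cmod (f x) \<le> B" for x using K(3)[of x] B by (cases "f x = 0") auto
  with B(1) that show thesis by blast
qed

lemma C0_mult_continuous:
  assumes "open \<Omega>" "f \<in> C0 \<Omega>" "continuous_on UNIV g"
  shows "(\<lambda>x. f x * g x) \<in> C0 \<Omega>"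
proof -
  obtain K where K: "compact K" "K \<subseteq> \<Omega>" "\<And>x. f x \<noteq> 0 \<Longrightarrow> x \<in> K"
    using assms(2) by (rule C0_supportE) blast
  show ?thesis
    by (rule C0I[OF _ K(1,2)]) (use K(3) assms C0_continuous in \<open>auto intro!: continuous_intros\<close>)
qed

lemma C0_scale:
  assumes "open \<Omega>" "f \<in> C0 \<Omega>"
  shows "(\<lambda>x. c * f x) \<in> C0 \<Omega>"
  using C0_mult_continuous[OF assms, of "\<lambda>_. c"] by (simp add: mult.commute)

lemma C0_cnj:
  assumes "open \<Omega>" "f \<in> C0 \<Omega>"
  shows "(\<lambda>x. cnj (f x)) \<in> C0 \<Omega>"
proof -
  obtain K where K: "compact K" "K \<subseteq> \<Omega>" "\<And>x. f x \<noteq> 0 \<Longrightarrow> x \<in> K"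
    using assms(2) by (rule C0_supportE) blast
  show ?thesis
    by (rule C0I[OF _ K(1,2)]) (use K(3) assms C0_continuous in \<open>auto intro!: continuous_intros\<close>)
qed

lemma C0_add:
  assumes "open \<Omega>" "f \<in> C0 \<Omega>" "g \<in> C0 \<Omega>"
  shows "(\<lambda>x. f x + g x) \<in> C0 \<Omega>"
proof -
  obtain K where K: "compact K" "K \<subseteq> \<Omega>" "\<And>x. f x \<noteq> 0 \<Longrightarrow> x \<in> K"
    using assms(2) by (rule C0_supportE) blast
  obtain L where L: "compact L" "L \<subseteq> \<Omega>" "\<And>x. g x \<noteq> 0 \<Longrightarrow> x \<in> L"
    using assms(3) by (rule C0_supportE) blast
  have "f x + g x \<noteq> 0 \<Longrightarrow> x \<in> K \<union> L" for x using K(3) L(3) by (cases "f x = 0") auto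
  then show ?thesis using assms K L C0_continuous
    by (intro C0I[of _ "K \<union> L"]) (auto intro!: continuous_intros)
qed

lemma C0_zero: "(\<lambda>x. 0) \<in> C0 \<Omega>"
  by (rule C0I[of _ "{}"]) auto

lemma C0_sum:
  assumes "open \<Omega>" "\<And>i. i \<in> I \<Longrightarrow> f i \<in> C0 \<Omega>"
  shows "(\<lambda>x. \<Sum>i\<in>I. f i x) \<in> C0 \<Omega>"
  using assms(2)
  by (induction I rule: infinite_finite_induct) (auto intro: C0_zero C0_add[OF assms(1)])

lemma C0_diff:
  assumes "open \<Omega>" "f \<in> C0 \<Omega>" "g \<in> C0 \<Omega>"
  shows "(\<lambda>x. f x - g x) \<in> C0 \<Omega>"
  using C0_add[OF assms(1,2) C0_scale[OF assms(1,3), of "-1"]] by simp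

lemma C0_Re:
  assumes "open \<Omega>" "f \<in> C0 \<Omega>"
  shows "(\<lambda>x. complex_of_real (Re (f x))) \<in> C0 \<Omega>"
proof -
  have "(\<lambda>x. complex_of_real (Re (f x))) = (\<lambda>x. (1/2) * (f x + cnj (f x)))"
    by (simp add: complex_add_cnj)
  then show ?thesis
    using C0_scale[OF assms(1) C0_add[OF assms C0_cnj[OF assms]], of "1/2"] by simp
qed

section \<open>Linearity and continuity of functionals\<close>

lemma dual_add: "\<mu> \<in> C0_dual \<Omega> \<Longrightarrow> f \<in> C0 \<Omega> \<Longrightarrow> g \<in> C0 \<Omega> \<Longrightarrow> \<mu> (\<lambda>x. f x + g x) = \<mu> f + \<mu> g"
  by (auto simp: C0_dual_def)

lemma dual_scale: "\<mu> \<in> C0_dual \<Omega> \<Longrightarrow> f \<in> C0 \<Omega> \<Longrightarrow> \<mu> (\<lambda>x. c * f x) = c * \<mu> f"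
  by (auto simp: C0_dual_def)

lemma dual_diff:
  assumes "open \<Omega>" "\<mu> \<in> C0_dual \<Omega>" "f \<in> C0 \<Omega>" "g \<in> C0 \<Omega>"
  shows "\<mu> (\<lambda>x. f x - g x) = \<mu> f - \<mu> g"
  using dual_add[OF assms(2,3) C0_scale[OF assms(1,4), of "-1"]] dual_scale[OF assms(2,4), of "-1"]
  by simp

lemma dual_zero: "\<mu> \<in> C0_dual \<Omega> \<Longrightarrow> \<mu> (\<lambda>x. 0) = 0"
  using dual_scale[OF _ C0_zero, of \<mu> \<Omega> 0] by simp

lemma dual_sum:
  assumes "open \<Omega>" "\<mu> \<in> C0_dual \<Omega>" "\<And>i. i \<in> I \<Longrightarrow> f i \<in> C0 \<Omega>"
  shows "\<mu> (\<lambda>x. \<Sum>i\<in>I. f i x) = (\<Sum>i\<in>I. \<mu> (f i))"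
  using assms(3)
  by (induction I rule: infinite_finite_induct)
     (auto simp: dual_zero[OF assms(2)] dual_add[OF assms(2)] C0_sum[OF assms(1)])

text \<open>Trades the supremum in \<open>C0_dual\<close> for an arbitrary pointwise bound
  \<open>b\<close>. Passing from \<open>C\<close> to \<open>max C 0\<close> makes the right-hand
  side monotone in \<open>b\<close>.\<close>

lemma dual_bound:
  assumes "\<mu> \<in> C0_dual \<Omega>" "compact K" "K \<subseteq> \<Omega>"
  obtains C where "C \<ge> 0"
    "\<And>f b. f \<in> C0 \<Omega> \<Longrightarrow> (\<And>x. f x \<noteq> 0 \<Longrightarrow> x \<in> K) \<Longrightarrow> (\<And>x. cmod (f x) \<le> b) \<Longrightarrow> cmod (\<mu> f) \<le> C * b"
proof -
  have "\<exists>C. \<forall>f\<in>C0 \<Omega>. {x. f x \<noteq> 0} \<subseteq> K \<longrightarrow> cmod (\<mu> f) \<le> C * (SUP x. cmod (f x))"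
    using assms by (simp add: C0_dual_def)
  then obtain C where C: "\<forall>f\<in>C0 \<Omega>. {x. f x \<noteq> 0} \<subseteq> K \<longrightarrow> cmod (\<mu> f) \<le> C * (SUP x. cmod (f x))" ..
  show thesis
  proof (rule that[of "max C 0"])
    fix f b
    assume f: "f \<in> C0 \<Omega>" "\<And>x. f x \<noteq> 0 \<Longrightarrow> x \<in> K" "\<And>x. cmod (f x) \<le> b"
    have "bdd_above (range (\<lambda>x. cmod (f x)))" using f(3) by (auto simp: bdd_above_def)
    then have s0: "(SUP x. cmod (f x)) \<ge> 0"
      by (rule cSUP_upper2[where x = 0]) auto
    have sb: "(SUP x. cmod (f x)) \<le> b" using f(3) by (intro cSUP_least) auto
    have "cmod (\<mu> f) \<le> C * (SUP x. cmod (f x))" using C f by auto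
    also have "\<dots> \<le> max C 0 * (SUP x. cmod (f x))" using s0 by (intro mult_right_mono) auto
    also have "\<dots> \<le> max C 0 * b" using sb by (intro mult_left_mono) auto
    finally show "cmod (\<mu> f) \<le> max C 0 * b" .
  qed auto
qed

text \<open>Converse of \<open>dual_bound\<close>: a function in \<open>C0\<close> is bounded, so
  its supremum is itself an admissible \<open>b\<close>.\<close>

lemma dualI:
  assumes "\<And>f g. f \<in> C0 \<Omega> \<Longrightarrow> g \<in> C0 \<Omega> \<Longrightarrow> \<mu> (\<lambda>x. f x + g x) = \<mu> f + \<mu> g"
    and "\<And>f c. f \<in> C0 \<Omega> \<Longrightarrow> \<mu> (\<lambda>x. c * f x) = c * \<mu> f"
    and "\<And>K. compact K \<Longrightarrow> K \<subseteq> \<Omega> \<Longrightarrow> \<exists>C. \<forall>f b. f \<in> C0 \<Omega> \<longrightarrow> (\<forall>x. f x \<noteq> 0 \<longrightarrow> x \<in> K) \<longrightarrow>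
           (\<forall>x. cmod (f x) \<le> b) \<longrightarrow> cmod (\<mu> f) \<le> C * b"
    and "open \<Omega>"
  shows "\<mu> \<in> C0_dual \<Omega>"
  unfolding C0_dual_def
proof (intro CollectI conjI ballI allI impI)
  fix K assume K: "compact K \<and> K \<subseteq> \<Omega>"
  obtain C where C: "\<And>f b. f \<in> C0 \<Omega> \<Longrightarrow> (\<forall>x. f x \<noteq> 0 \<longrightarrow> x \<in> K) \<Longrightarrow>
           (\<forall>x. cmod (f x) \<le> b) \<Longrightarrow> cmod (\<mu> f) \<le> C * b"
    using assms(3) K by metis
  show "\<exists>C. \<forall>f\<in>C0 \<Omega>. {x. f x \<noteq> 0} \<subseteq> K \<longrightarrow> cmod (\<mu> f) \<le> C * (SUP x. cmod (f x))"
  proof (intro exI[of _ C] ballI impI)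
    fix f assume f: "f \<in> C0 \<Omega>" "{x. f x \<noteq> 0} \<subseteq> K"
    obtain B where "\<And>x. cmod (f x) \<le> B" using C0_bounded[OF assms(4) f(1)] by metis
    then have "bdd_above (range (\<lambda>x. cmod (f x)))" by (auto simp: bdd_above_def)
    then have "\<forall>x. cmod (f x) \<le> (SUP x. cmod (f x))" by (auto intro: cSUP_upper)
    then show "cmod (\<mu> f) \<le> C * (SUP x. cmod (f x))" using C f by blast
  qed
qed (use assms in auto)

section \<open>Closure of the dual under conjugation and linear combinations\<close>

lemma dual_meas_cnj:
  assumes "open \<Omega>" "\<mu> \<in> C0_dual \<Omega>"
  shows "meas_cnj \<mu> \<in> C0_dual \<Omega>"
proof (rule dualI)
  fix K assume K: "compact K" "K \<subseteq> \<Omega>"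
  obtain C where C: "C \<ge> 0"
    "\<And>f b. f \<in> C0 \<Omega> \<Longrightarrow> (\<And>x. f x \<noteq> 0 \<Longrightarrow> x \<in> K) \<Longrightarrow> (\<And>x. cmod (f x) \<le> b) \<Longrightarrow> cmod (\<mu> f) \<le> C * b"
    using dual_bound[OF assms(2) K] by metis
  show "\<exists>C. \<forall>f b. f \<in> C0 \<Omega> \<longrightarrow> (\<forall>x. f x \<noteq> 0 \<longrightarrow> x \<in> K) \<longrightarrow>
           (\<forall>x. cmod (f x) \<le> b) \<longrightarrow> cmod (meas_cnj \<mu> f) \<le> C * b"
    using C(2)[OF C0_cnj[OF assms(1)]] by (intro exI[of _ C]) (auto simp: meas_cnj_def)
qed (use assms in \<open>auto simp: meas_cnj_def dual_add[OF assms(2) C0_cnj C0_cnj]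
      dual_scale[OF assms(2) C0_cnj]\<close>)

lemma dual_lincomb:
  assumes "open \<Omega>" "\<mu> \<in> C0_dual \<Omega>" "\<nu> \<in> C0_dual \<Omega>"
  shows "(\<lambda>f. a * \<mu> f + b * \<nu> f) \<in> C0_dual \<Omega>"
proof (rule dualI)
  fix K assume K: "compact K" "K \<subseteq> \<Omega>"
  obtain C where C: "C \<ge> 0"
    "\<And>f b. f \<in> C0 \<Omega> \<Longrightarrow> (\<And>x. f x \<noteq> 0 \<Longrightarrow> x \<in> K) \<Longrightarrow> (\<And>x. cmod (f x) \<le> b) \<Longrightarrow> cmod (\<mu> f) \<le> C * b"
    using dual_bound[OF assms(2) K] by metis
  obtain D where D: "D \<ge> 0"
    "\<And>f b. f \<in> C0 \<Omega> \<Longrightarrow> (\<And>x. f x \<noteq> 0 \<Longrightarrow> x \<in> K) \<Longrightarrow> (\<And>x. cmod (f x) \<le> b) \<Longrightarrow> cmod (\<nu> f) \<le> D * b"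
    using dual_bound[OF assms(3) K] by metis
  have "cmod (a * \<mu> f + b * \<nu> f) \<le> (cmod a * C + cmod b * D) * m"
    if "f \<in> C0 \<Omega>" "\<forall>x. f x \<noteq> 0 \<longrightarrow> x \<in> K" "\<forall>x. cmod (f x) \<le> m" for f m
  proof -
    have "cmod (a * \<mu> f + b * \<nu> f) \<le> cmod a * cmod (\<mu> f) + cmod b * cmod (\<nu> f)"
      by (metis norm_mult norm_triangle_ineq)
    also have "\<dots> \<le> cmod a * (C * m) + cmod b * (D * m)"
      using C(2)[of f m] D(2)[of f m] that by (intro add_mono mult_left_mono) auto
    finally show ?thesis by (simp add: algebra_simps)
  qed
  then show "\<exists>C. \<forall>f b'. f \<in> C0 \<Omega> \<longrightarrow> (\<forall>x. f x \<noteq> 0 \<longrightarrow> x \<in> K) \<longrightarrow>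
           (\<forall>x. cmod (f x) \<le> b') \<longrightarrow> cmod (a * \<mu> f + b * \<nu> f) \<le> C * b'"
    by blast
qed (use assms in \<open>auto simp: dual_add dual_scale algebra_simps\<close>)

lemma dual_null: "open \<Omega> \<Longrightarrow> (\<lambda>f. 0) \<in> C0_dual \<Omega>"
  by (rule dualI) (auto intro!: exI[of _ 0])

lemma dual_weighted_sum:
  assumes "open \<Omega>" "\<And>i. i \<in> I \<Longrightarrow> \<mu> i \<in> C0_dual \<Omega>"
  shows "(\<lambda>f. \<Sum>i\<in>I. c i * \<mu> i f) \<in> C0_dual \<Omega>"
  using assms(2)
proof (induction I rule: infinite_finite_induct)
  case (insert x F)
  then have "(\<lambda>f. c x * \<mu> x f + 1 * (\<Sum>i\<in>F. c i * \<mu> i f)) \<in> C0_dual \<Omega>"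
    by (intro dual_lincomb[OF \<open>open \<Omega>\<close>]) auto
  then show ?case using insert by simp
qed (auto simp: dual_null[OF assms(1)])

text \<open>Sequential continuity for the inductive limit topology: the supports stay in one compact
  \<open>K\<close>, so a single constant of \<open>dual_bound\<close> turns uniform convergence into
  convergence of the values.\<close>

lemma dual_tendsto:
  assumes "open \<Omega>" "\<mu> \<in> C0_dual \<Omega>" "compact K" "K \<subseteq> \<Omega>"
    and "\<And>n. f n \<in> C0 \<Omega>" "g \<in> C0 \<Omega>"
    and "\<And>n x. f n x \<noteq> 0 \<Longrightarrow> x \<in> K" "\<And>x. g x \<noteq> 0 \<Longrightarrow> x \<in> K"
    and "\<And>n x. cmod (f n x - g x) \<le> b n" "b \<longlonglongrightarrow> 0"
  shows "(\<lambda>n. \<mu> (f n)) \<longlonglongrightarrow> \<mu> g"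
proof -
  obtain C where C: "C \<ge> 0"
    "\<And>f b. f \<in> C0 \<Omega> \<Longrightarrow> (\<And>x. f x \<noteq> 0 \<Longrightarrow> x \<in> K) \<Longrightarrow> (\<And>x. cmod (f x) \<le> b) \<Longrightarrow> cmod (\<mu> f) \<le> C * b"
    using dual_bound[OF assms(2-4)] by metis
  have "cmod (\<mu> (f n) - \<mu> g) \<le> C * b n" for n
  proof -
    have "f n x - g x \<noteq> 0 \<Longrightarrow> x \<in> K" for x
      using assms(7)[of n x] assms(8)[of x] by (cases "g x = 0") auto
    then show ?thesis
      using C(2)[of "\<lambda>x. f n x - g x" "b n"] assms(9) C0_diff[OF assms(1), of "f n" g]
        dual_diff[OF assms(1,2), of "f n" g] assms(5,6) by auto
  qed
  moreover have "(\<lambda>n. C * b n) \<longlonglongrightarrow> 0" using tendsto_mult_left[OF assms(10), of C] by simp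
  ultimately have "(\<lambda>n. \<mu> (f n) - \<mu> g) \<longlonglongrightarrow> 0"
    by (intro Lim_null_comparison[of "\<lambda>n. \<mu> (f n) - \<mu> g" "\<lambda>n. C * b n"]) auto
  then show ?thesis by (simp add: LIM_zero_iff)
qed

section \<open>Partitions of unity\<close>

text \<open>The partial derivatives \<open>g k\<close> are carried along as explicit data, so that
  gradients of test functions can be computed by rules. They are taken along the axes at parameter
  0, as in \<open>partial\<close>.\<close>

definition C1 :: "(real^'n \<Rightarrow> real) \<Rightarrow> ('n \<Rightarrow> real^'n \<Rightarrow> real) \<Rightarrow> bool" where
  "C1 f g \<longleftrightarrow> continuous_on UNIV f \<and> (\<forall>k. continuous_on UNIV (g k) \<and>
     (\<forall>x. ((\<lambda>t. f (x + t *\<^sub>R axis k 1)) has_real_derivative g k x) (at 0)))"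

section \<open>Calculus rules for \<open>C1\<close>\<close>

lemma C1_const: "C1 (\<lambda>x. c) (\<lambda>k x. 0)"
  by (auto simp: C1_def)

lemma C1_coord: "C1 (\<lambda>x. x $ i) (\<lambda>k x. if i = k then 1 else 0)"
  by (auto simp: C1_def axis_def intro!: continuous_intros derivative_eq_intros)

lemma C1_add: "C1 f f' \<Longrightarrow> C1 g g' \<Longrightarrow> C1 (\<lambda>x. f x + g x) (\<lambda>k x. f' k x + g' k x)"
  by (auto simp: C1_def intro!: continuous_intros derivative_eq_intros)

lemma C1_mult:
  "C1 f f' \<Longrightarrow> C1 g g' \<Longrightarrow> C1 (\<lambda>x. f x * g x) (\<lambda>k x. f x * g' k x + f' k x * g x)"
  by (auto simp: C1_def intro!: continuous_intros derivative_eq_intros)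

lemma C1_compose:
  assumes "C1 f f'" "\<And>y. (h has_real_derivative h' y) (at y)" "continuous_on UNIV h'"
  shows "C1 (\<lambda>x. h (f x)) (\<lambda>k x. h' (f x) * f' k x)"
proof -
  have h: "continuous_on UNIV h" using assms(2) by (meson DERIV_continuous_on has_field_derivative_at_within)
  have "((\<lambda>t. h (f (x + t *\<^sub>R axis k 1))) has_real_derivative h' (f x) * f' k x) (at 0)" for x k
    using assms(1) DERIV_chain2[of h "h' (f x)" "\<lambda>t. f (x + t *\<^sub>R axis k 1)" 0] assms(2)
    by (auto simp: C1_def)
  then show ?thesis using assms(1,3) h
    by (auto simp: C1_def intro!: continuous_intros continuous_on_compose2[of UNIV h]
        continuous_on_compose2[of UNIV h'])
qed

lemma C1_inverse:
  assumes "C1 f f'" "\<And>x. f x \<noteq> 0"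
  shows "C1 (\<lambda>x. inverse (f x)) (\<lambda>k x. - (inverse (f x) * f' k x * inverse (f x)))"
  using assms by (auto simp: C1_def intro!: continuous_intros DERIV_inverse' derivative_eq_intros)

lemma C1_sum:
  assumes "\<And>i. i \<in> I \<Longrightarrow> C1 (f i) (f' i)"
  shows "C1 (\<lambda>x. \<Sum>i\<in>I. f i x) (\<lambda>k x. \<Sum>i\<in>I. f' i k x)"
  using assms
  by (induction I rule: infinite_finite_induct) (auto intro: C1_const C1_add)

text \<open>In every combination of signs of \<open>y\<close> and \<open>y + h\<close> the first
  order expansion has an error of at most \<open>h * h\<close>, so the difference quotient is within
  \<open>\<bar>h\<bar>\<close> of its limit. Squaring is what smooths the kink of the positive
  part.\<close>

lemma pos_part_square_deriv: "((\<lambda>y::real. (max 0 y)\<^sup>2) has_real_derivative 2 * max 0 y) (at y)"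
  unfolding DERIV_def
proof (rule LIM_zero_cancel, rule Lim_null_comparison[of _ "\<lambda>h. \<bar>h\<bar>"])
  have "\<bar>((max 0 (y + h))\<^sup>2 - (max 0 y)\<^sup>2) / h - 2 * max 0 y\<bar> \<le> \<bar>h\<bar>" if "h \<noteq> 0" for h
  proof -
    have "\<bar>(max 0 (y + h))\<^sup>2 - (max 0 y)\<^sup>2 - 2 * max 0 y * h\<bar> \<le> \<bar>h\<bar> * \<bar>h\<bar>"
    proof (cases "0 \<le> y"; cases "0 \<le> y + h")
      assume *: "0 \<le> y" "\<not> 0 \<le> y + h"
      then have "y * y \<le> - h * y" "0 \<le> - h * y" by (intro mult_right_mono mult_nonneg_nonneg; simp)+
      moreover have "0 \<le> (y + h) * (y + h)" by simp
      ultimately have "\<bar>- (y * y) - 2 * y * h\<bar> \<le> \<bar>h\<bar> * \<bar>h\<bar>"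
        by (simp add: algebra_simps abs_le_iff)
      then show ?thesis using * by (simp add: max_def power2_eq_square)
    next
      assume *: "\<not> 0 \<le> y" "0 \<le> y + h"
      then have "(y + h) * (y + h) \<le> h * h" by (intro mult_mono) auto
      then show ?thesis using * by (simp add: max_def power2_eq_square)
    qed (auto simp: max_def power2_eq_square algebra_simps)
    then have "\<bar>(max 0 (y + h))\<^sup>2 - (max 0 y)\<^sup>2 - 2 * max 0 y * h\<bar> / \<bar>h\<bar> \<le> \<bar>h\<bar>"
      using that by (simp add: divide_le_eq)
    moreover have "\<bar>(max 0 (y + h))\<^sup>2 - (max 0 y)\<^sup>2 - 2 * max 0 y * h\<bar> / \<bar>h\<bar>
        = \<bar>((max 0 (y + h))\<^sup>2 - (max 0 y)\<^sup>2) / h - 2 * max 0 y\<bar>"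
      using that by (simp add: diff_divide_distrib flip: abs_divide)
    ultimately show ?thesis by simp
  qed
  then show "\<forall>\<^sub>F h in at 0. norm (((max 0 (y + h))\<^sup>2 - (max 0 y)\<^sup>2) / h - 2 * max 0 y) \<le> \<bar>h\<bar>"
    by (auto simp: eventually_at_filter)
qed (auto intro!: tendsto_eq_intros)

lemma C1_pos_part_square: "C1 f f' \<Longrightarrow> C1 (\<lambda>x. (max 0 (f x))\<^sup>2) (\<lambda>k x. 2 * max 0 (f x) * f' k x)"
  by (rule C1_compose[OF _ pos_part_square_deriv]) (auto intro!: continuous_intros)

lemma C1_dist_square: "\<exists>g. C1 (\<lambda>x::real^'n. (dist x a)\<^sup>2) g"
proof -
  have "(dist x a)\<^sup>2 = (\<Sum>i\<in>UNIV. (x $ i + - (a $ i)) * (x $ i + - (a $ i)))" for x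
    by (simp add: dist_norm norm_vec_def L2_set_def power2_eq_square sum_nonneg)
  moreover have "\<exists>g. C1 (\<lambda>x. \<Sum>i\<in>UNIV. (x $ i + - (a $ i)) * (x $ i + - (a $ i))) g"
    by (rule exI, rule C1_sum, rule C1_mult; rule C1_add[OF C1_coord C1_const])
  ultimately show ?thesis by simp
qed

text \<open>
  A partition of unity by normalised hats. Dividing by \<open>max H \<eta>\<close> would not be differentiable,
  hence the correction term \<open>(max 0 (\<eta> - H))\<^sup>2\<close> in the denominator.
\<close>

lemma C1_partition_of_unity:
  fixes S :: "(real^'n) set"
  assumes "compact S" "\<delta> > 0"
  obtains I \<phi> where "finite I" "\<And>i. i \<in> I \<Longrightarrow> \<exists>g. C1 (\<phi> i) g"
    "\<And>i x. \<phi> i x \<ge> 0" "\<And>i x. \<phi> i x \<noteq> 0 \<Longrightarrow> dist x i < \<delta>" "I \<subseteq> S"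
    "\<And>x. (\<Sum>i\<in>I. \<phi> i x) \<le> 1" "\<And>x. x \<in> S \<Longrightarrow> (\<Sum>i\<in>I. \<phi> i x) = 1"
proof -
  obtain I where I: "finite I" "I \<subseteq> S" "S \<subseteq> (\<Union>i\<in>I. ball i \<delta>)"
  proof (rule compactE_image[OF assms(1), of S "\<lambda>i. ball i \<delta>"])
    show "S \<subseteq> (\<Union>i\<in>S. ball i \<delta>)"
    proof
      fix x assume "x \<in> S"
      moreover have "x \<in> ball x \<delta>" using assms(2) by (simp only: centre_in_ball)
      ultimately show "x \<in> (\<Union>i\<in>S. ball i \<delta>)" by (rule UN_I)
    qed
    show "open (ball i \<delta>)" for i by simp
  qed
  \<comment> \<open>Hats built from the squared distance, since the distance itself is not
    differentiable at \<open>i\<close>; the outer square makes the cut-off at radius \<delta>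
    continuously differentiable.\<close>
  define h where "h i x = (max 0 (\<delta>\<^sup>2 - (dist x i)\<^sup>2))\<^sup>2" for i x :: "real^'n"
  define H where "H x = (\<Sum>i\<in>I. h i x)" for x
  have h: "\<exists>g. C1 (h i) g" for i
  proof -
    obtain g where "C1 (\<lambda>x. (dist x i)\<^sup>2) g" using C1_dist_square by blast
    from C1_pos_part_square[OF C1_add[OF C1_const[of "\<delta>\<^sup>2"] C1_mult[OF C1_const[of "-1"] this]]]
    show ?thesis unfolding h_def by auto
  qed
  then obtain h' where h': "\<And>i. C1 (h i) (h' i)" by metis
  have H: "C1 H (\<lambda>k x. \<Sum>i\<in>I. h' i k x)" unfolding H_def by (rule C1_sum) (rule h')
  have hpos: "h i x > 0 \<longleftrightarrow> dist x i < \<delta>" for i x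
  proof -
    have "(dist x i)\<^sup>2 < \<delta>\<^sup>2 \<longleftrightarrow> dist x i < \<delta>"
      using assms(2) by (simp add: power_mono_iff flip: not_le)
    then show ?thesis by (auto simp: h_def max_def)
  qed
  have h0: "h i x \<ge> 0" for i x by (simp add: h_def)
  have H0: "H x \<ge> 0" for x using h0 by (simp add: H_def sum_nonneg)
  have Hpos: "H x > 0" if "x \<in> S" for x
  proof -
    obtain i where "i \<in> I" "dist x i < \<delta>" using subsetD[OF I(3) \<open>x \<in> S\<close>] by (auto simp: dist_commute)
    then show ?thesis unfolding H_def using I(1) h0 hpos by (intro sum_pos2[of I i]) auto
  qed
  obtain \<eta> where \<eta>: "\<eta> > 0" "\<And>x. x \<in> S \<Longrightarrow> \<eta> \<le> H x"
  proof (cases "S = {}")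
    case False
    have "continuous_on S H" using H by (auto simp: C1_def intro: continuous_on_subset)
    then obtain y where "y \<in> S" "\<And>x. x \<in> S \<Longrightarrow> H y \<le> H x"
      using continuous_attains_inf[OF assms(1) False] by blast
    then show ?thesis using that Hpos by blast
  qed (use that[of 1] in auto)
  \<comment> \<open>On \<open>S\<close> the correction vanishes because \<open>H\<close> is at least
    \<eta> there, so the quotients sum to exactly 1. Elsewhere \<open>D \<ge> H\<close> keeps the
    sum at most 1, and where \<open>H\<close> is zero the correction equals the square of \<eta>, so
    \<open>D\<close> never vanishes.\<close>
  define D where "D x = H x + (max 0 (\<eta> + (-1) * H x))\<^sup>2" for x
  have D: "\<exists>g. C1 D g"
    unfolding D_def
    using C1_add[OF H C1_pos_part_square[OF C1_add[OF C1_const[of \<eta>] C1_mult[OF C1_const[of "-1"] H]]]]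
    by blast
  have Dpos: "D x > 0" for x
    using H0[of x] \<eta>(1) by (cases "H x < \<eta>") (auto simp: D_def add_nonneg_pos)
  have DH: "D x \<ge> H x" for x by (simp add: D_def)
  have DS: "D x = H x" if "x \<in> S" for x using \<eta>(2)[OF that] by (simp add: D_def)
  have sum: "(\<Sum>i\<in>I. h i x * inverse (D x)) = H x / D x" for x
    by (simp add: H_def sum_distrib_right divide_inverse)
  show thesis
  proof (rule that[of I "\<lambda>i x. h i x * inverse (D x)"])
    show "\<exists>g. C1 (\<lambda>x. h i x * inverse (D x)) g" for i
    proof -
      obtain g where "C1 D g" using D by blast
      then have "C1 (\<lambda>x. inverse (D x)) (\<lambda>k x. - (inverse (D x) * g k x * inverse (D x)))"
        using Dpos by (intro C1_inverse) (auto simp: less_imp_neq[THEN not_sym])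
      from C1_mult[OF h' this] show ?thesis by blast
    qed
    show "h i x * inverse (D x) \<ge> 0" for i x using h0 Dpos[of x] by (simp add: less_imp_le)
    show "dist x i < \<delta>" if "h i x * inverse (D x) \<noteq> 0" for i x
      using that hpos[of i x] h0[of i x] by auto
    show "(\<Sum>i\<in>I. h i x * inverse (D x)) \<le> 1" for x
      unfolding sum using DH[of x] Dpos[of x] by simp
    show "(\<Sum>i\<in>I. h i x * inverse (D x)) = 1" if "x \<in> S" for x
      unfolding sum using DS[OF that] Dpos[of x] by simp
  qed (use I in auto)
qed

text \<open>The indices \<open>i\<close> are themselves points of the space, at which a function is
  going to be sampled. The conditions are bundled so that a sequence of such families can be
  chosen.\<close>

definition C1_bumps ::
  "(real^'n) set \<Rightarrow> (real^'n) set \<Rightarrow> (real^'n \<Rightarrow> real^'n \<Rightarrow> real) \<Rightarrow> bool" where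
  "C1_bumps K I \<phi> \<longleftrightarrow> finite I \<and> (\<forall>i\<in>I. (\<exists>g. C1 (\<phi> i) g) \<and> (\<forall>x. 0 \<le> \<phi> i x) \<and> (\<forall>x. \<phi> i x \<noteq> 0 \<longrightarrow> x \<in> K))"

text \<open>At a scale \<delta> of uniform continuity, \<open>f j x\<close> is an average of samples
  \<open>f j i\<close> with \<open>i\<close> close to \<open>x\<close>, weighted by a partition of
  unity. The same bumps serve all \<open>j\<close>, and one compact \<open>K\<close> serves all
  \<open>n\<close>, as \<open>dual_tendsto\<close> requires.\<close>

lemma C0_approximation:
  fixes \<Omega> :: "(real^'n) set" and f :: "'j \<Rightarrow> real^'n \<Rightarrow> complex"
  assumes "open \<Omega>" "finite J" "\<And>j. j \<in> J \<Longrightarrow> f j \<in> C0 \<Omega>"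
  obtains K I \<phi> where "compact K" "K \<subseteq> \<Omega>" "\<forall>j\<in>J. \<forall>x. f j x \<noteq> 0 \<longrightarrow> x \<in> K"
    "\<forall>n. C1_bumps K (I n) (\<phi> n)"
    "\<forall>n. \<forall>j\<in>J. \<forall>x. cmod ((\<Sum>i\<in>I n. complex_of_real (\<phi> n i x) * f j i) - f j x) \<le> 1 / real (Suc n)"
proof -
  have "\<forall>j\<in>J. \<exists>S. compact S \<and> S \<subseteq> \<Omega> \<and> (\<forall>x. f j x \<noteq> 0 \<longrightarrow> x \<in> S)"
    using assms(3) by (metis C0_supportE)
  then obtain s where s: "\<And>j. j \<in> J \<Longrightarrow> compact (s j)" "\<And>j. j \<in> J \<Longrightarrow> s j \<subseteq> \<Omega>"
    "\<And>j x. j \<in> J \<Longrightarrow> f j x \<noteq> 0 \<Longrightarrow> x \<in> s j" by metis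
  define S where "S = (\<Union>j\<in>J. s j)"
  have S: "compact S" "S \<subseteq> \<Omega>" using assms(2) s by (auto simp: S_def)
  obtain r where r: "r > 0" "(\<Union>x\<in>S. ball x r) \<subseteq> \<Omega>"
    using compact_subset_open_imp_ball_epsilon_subset[OF S(1) assms(1) S(2)] by blast
  \<comment> \<open>The closed \<open>r/2\<close>-neighbourhood of the supports: still compact
    inside \<Omega>, with room for bumps of radius at most \<open>r/2\<close> centred in
    \<open>S\<close>.\<close>
  define K where "K = {x + y |x y. x \<in> S \<and> y \<in> cball 0 (r/2)}"
  have Kmem: "x \<in> K" if "i \<in> S" "dist x i \<le> r/2" for x i
  proof -
    have "x = i + (x - i)" "x - i \<in> cball 0 (r/2)" using that by (auto simp: dist_norm norm_minus_commute)
    then show ?thesis unfolding K_def using that by blast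
  qed
  have K: "compact K" unfolding K_def by (intro compact_sums S) auto
  have K\<Omega>: "K \<subseteq> \<Omega>"
    proof
      fix z assume "z \<in> K"
      then obtain x y where "z = x + y" "x \<in> S" "norm y \<le> r/2" by (auto simp: K_def)
      then have "z \<in> ball x r" using r(1) by (auto simp: dist_norm)
      then show "z \<in> \<Omega>" using r(2) \<open>x \<in> S\<close> by blast
    qed
  have K0: "x \<in> K" if "j \<in> J" "f j x \<noteq> 0" for j x
      using s(3)[OF that] that(1) r(1) by (intro Kmem[of x]) (auto simp: S_def)
  have main: "\<exists>I \<phi>. C1_bumps K I \<phi> \<and>
       (\<forall>j\<in>J. \<forall>x. cmod ((\<Sum>i\<in>I. complex_of_real (\<phi> i x) * f j i) - f j x) \<le> \<epsilon>)" if \<epsilon>: "\<epsilon> > 0" for \<epsilon>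
  proof -
    have "\<exists>d>0. \<forall>x\<in>K. \<forall>y\<in>K. dist x y < d \<longrightarrow> dist (f j x) (f j y) < \<epsilon>" if "j \<in> J" for j
    proof -
      have "uniformly_continuous_on K (f j)"
        using C0_continuous[OF assms(1) assms(3)[OF that]] K
        by (meson compact_uniformly_continuous continuous_on_subset subset_UNIV)
      then show ?thesis using \<epsilon> unfolding uniformly_continuous_on_def by (metis dist_commute)
    qed
    then obtain d where d: "\<And>j. j \<in> J \<Longrightarrow> d j > 0"
      "\<And>j x y. j \<in> J \<Longrightarrow> x \<in> K \<Longrightarrow> y \<in> K \<Longrightarrow> dist x y < d j \<Longrightarrow> dist (f j x) (f j y) < \<epsilon>"
      by metis
    \<comment> \<open>The bound \<open>r/2\<close> keeps the bumps inside \<open>K\<close>, the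
      bounds \<open>d j\<close> control the oscillation of the \<open>f j\<close>. The inserted
      element also makes the minimum meaningful for empty \<open>J\<close>.\<close>
    define \<delta> where "\<delta> = Min (insert (r/2) (d ` J))"
    have \<delta>: "\<delta> > 0" "\<delta> \<le> r/2" "\<And>j. j \<in> J \<Longrightarrow> \<delta> \<le> d j"
      using d(1) r(1) assms(2) unfolding \<delta>_def by (simp, intro Min_le, auto intro: Min_le)
    obtain I \<phi> where \<phi>: "finite I" "\<And>i. i \<in> I \<Longrightarrow> \<exists>g. C1 (\<phi> i) g"
      "\<And>i x. \<phi> i x \<ge> 0" "\<And>i x. \<phi> i x \<noteq> 0 \<Longrightarrow> dist x i < \<delta>" "I \<subseteq> S"
      "\<And>x. (\<Sum>i\<in>I. \<phi> i x) \<le> 1" "\<And>x. x \<in> S \<Longrightarrow> (\<Sum>i\<in>I. \<phi> i x) = 1"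
      using C1_partition_of_unity[OF S(1) \<delta>(1)] by blast
    have "cmod ((\<Sum>i\<in>I. complex_of_real (\<phi> i x) * f j i) - f j x) \<le> \<epsilon>" if j: "j \<in> J" for j x
    proof -
      \<comment> \<open>Off \<open>S\<close> the weights may sum to less than 1, but
        \<open>f j x\<close> is zero there.\<close>
      have "f j x = (\<Sum>i\<in>I. complex_of_real (\<phi> i x) * f j x)"
      proof (cases "x \<in> S")
        case True
        then show ?thesis using \<phi>(7)[OF True]
          by (metis (no_types) mult.left_neutral of_real_1 of_real_sum sum_distrib_right)
      next
        case False
        then have "f j x = 0" using s(3)[OF j] j by (auto simp: S_def)
        then show ?thesis by simp
      qed
      then have "(\<Sum>i\<in>I. complex_of_real (\<phi> i x) * f j i) - f j x
          = (\<Sum>i\<in>I. complex_of_real (\<phi> i x) * (f j i - f j x))"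
        by (simp add: right_diff_distrib sum_subtractf)
      also have "cmod \<dots> \<le> (\<Sum>i\<in>I. \<phi> i x * \<epsilon>)"
      proof (rule sum_norm_le)
        fix i assume i: "i \<in> I"
        show "cmod (complex_of_real (\<phi> i x) * (f j i - f j x)) \<le> \<phi> i x * \<epsilon>"
        proof (cases "\<phi> i x = 0")
          case False
          then have "dist x i < \<delta>" by (rule \<phi>(4))
          moreover have "i \<in> S" using i \<phi>(5) by blast
          ultimately have "dist (f j i) (f j x) < \<epsilon>"
            using \<delta>(2) \<delta>(3)[OF j] r(1) by (intro d(2)[OF j] Kmem[of i]) (auto simp: dist_commute)
          then show ?thesis using \<phi>(3)[of i x]
            by (auto simp: norm_mult dist_norm intro!: mult_left_mono)
        qed simp
      qed
      also have "\<dots> = (\<Sum>i\<in>I. \<phi> i x) * \<epsilon>" by (simp add: sum_distrib_right)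
      also have "\<dots> \<le> 1 * \<epsilon>" using \<phi>(6) \<epsilon> by (intro mult_right_mono) auto
      finally show ?thesis by simp
    qed
    moreover have "x \<in> K" if "i \<in> I" "\<phi> i x \<noteq> 0" for i x
      using \<phi>(4)[OF that(2)] \<delta>(2) that(1) \<phi>(5) by (intro Kmem[of i]) auto
    ultimately show ?thesis
      using \<phi>(1,2,3) by (intro exI[of _ I] exI[of _ \<phi>]) (auto simp: C1_bumps_def)
  qed
  have "\<forall>n. \<exists>I \<phi>. C1_bumps K I \<phi> \<and> (\<forall>j\<in>J. \<forall>x. cmod ((\<Sum>i\<in>I. complex_of_real (\<phi> i x) * f j i) - f j x) \<le> 1 / real (Suc n))"
    by (intro allI main) simp
  from choice[OF this] obtain I where
    "\<forall>n. \<exists>\<phi>. C1_bumps K (I n) \<phi> \<and> (\<forall>j\<in>J. \<forall>x. cmod ((\<Sum>i\<in>I n. complex_of_real (\<phi> i x) * f j i) - f j x) \<le> 1 / real (Suc n))" ..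
  from choice[OF this] obtain \<phi> where
    "\<forall>n. C1_bumps K (I n) (\<phi> n) \<and> (\<forall>j\<in>J. \<forall>x. cmod ((\<Sum>i\<in>I n. complex_of_real (\<phi> n i x) * f j i) - f j x) \<le> 1 / real (Suc n))" ..
  then show thesis using K K\<Omega> K0 by (intro that[of K I \<phi>]) auto
qed

section \<open>Positivity and density\<close>

text \<open>Passes from constant vectors to fields. In \<open>pos\<close> the values
  \<open>f j x\<close> are frozen at one point while \<phi> stays variable. Replacing
  \<open>f j\<close> by its sampled sum and exchanging the sums gives one term of the form in
  \<open>pos\<close> for each bump \<phi> with sample point \<open>i\<close>; then the approximation
  is refined.\<close>

lemma dual_pos:
  fixes \<Omega> :: "(real^'n) set" and f :: "'j \<Rightarrow> real^'n \<Rightarrow> complex"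
  assumes "open \<Omega>" "finite J" "\<And>j. j \<in> J \<Longrightarrow> \<mu> j \<in> C0_dual \<Omega>" "\<And>j. j \<in> J \<Longrightarrow> f j \<in> C0 \<Omega>"
    and pos: "\<And>\<phi> x. (\<lambda>x. complex_of_real (\<phi> x)) \<in> C0 \<Omega> \<Longrightarrow> (\<forall>x. 0 \<le> \<phi> x) \<Longrightarrow>
        0 \<le> Re (\<Sum>j\<in>J. \<mu> j (\<lambda>y. complex_of_real (\<phi> y)) * f j x)"
  shows "0 \<le> Re (\<Sum>j\<in>J. \<mu> j (f j))"
proof -
  obtain K I \<phi> where K: "compact K" "K \<subseteq> \<Omega>" "\<forall>j\<in>J. \<forall>x. f j x \<noteq> 0 \<longrightarrow> x \<in> K"
    and bumps: "\<forall>n. C1_bumps K (I n) (\<phi> n)"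
    and close: "\<forall>n. \<forall>j\<in>J. \<forall>x. cmod ((\<Sum>i\<in>I n. complex_of_real (\<phi> n i x) * f j i) - f j x) \<le> 1 / real (Suc n)"
    by (rule C0_approximation[OF assms(1,2,4)]) (assumption, rule that)
  have a: "finite (I n) \<and> (\<forall>i\<in>I n. (\<exists>g. C1 (\<phi> n i) g) \<and> (\<forall>x. \<phi> n i x \<ge> 0) \<and>
      (\<forall>x. \<phi> n i x \<noteq> 0 \<longrightarrow> x \<in> K))" for n
    using bumps by (simp add: C1_bumps_def)
  define g where "g n j x = (\<Sum>i\<in>I n. complex_of_real (\<phi> n i x) * f j i)" for n j x
  have \<phi>: "(\<lambda>x. complex_of_real (\<phi> n i x)) \<in> C0 \<Omega>" if "i \<in> I n" for n i
    using a that by (intro C0I[OF _ K(1,2)]) (auto simp: C1_def intro!: continuous_intros)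
  have \<phi>': "(\<lambda>x. f j i * complex_of_real (\<phi> n i x)) \<in> C0 \<Omega>" if "i \<in> I n" for n i j
    by (rule C0_scale[OF assms(1) \<phi>[OF that]])
  have gC0: "g n j \<in> C0 \<Omega>" for n j
    unfolding g_def using \<phi>' by (intro C0_sum[OF assms(1)]) (simp add: mult.commute)
  have gval: "\<mu> j (g n j) = (\<Sum>i\<in>I n. \<mu> j (\<lambda>x. complex_of_real (\<phi> n i x)) * f j i)" if j: "j \<in> J" for n j
  proof -
    have "g n j = (\<lambda>x. \<Sum>i\<in>I n. f j i * complex_of_real (\<phi> n i x))"
      by (simp add: g_def fun_eq_iff mult.commute)
    then have "\<mu> j (g n j) = (\<Sum>i\<in>I n. \<mu> j (\<lambda>x. f j i * complex_of_real (\<phi> n i x)))"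
      using dual_sum[OF assms(1) assms(3)[OF j], of "I n" "\<lambda>i x. f j i * complex_of_real (\<phi> n i x)"] \<phi>'
      by simp
    also have "\<dots> = (\<Sum>i\<in>I n. \<mu> j (\<lambda>x. complex_of_real (\<phi> n i x)) * f j i)"
      by (rule sum.cong[OF refl]) (simp add: dual_scale[OF assms(3)[OF j] \<phi>] mult.commute)
    finally show ?thesis .
  qed
  have "(\<lambda>n. \<mu> j (g n j)) \<longlonglongrightarrow> \<mu> j (f j)" if j: "j \<in> J" for j
  proof (rule dual_tendsto[OF assms(1) assms(3)[OF j] K(1,2)])
    show "x \<in> K" if "g n j x \<noteq> 0" for n x
    proof -
      have "\<exists>i\<in>I n. complex_of_real (\<phi> n i x) * f j i \<noteq> 0"
        using that unfolding g_def by (rule contrapos_np) (simp add: sum.neutral)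
      then show ?thesis using a by auto
    qed
    show "cmod (g n j x - f j x) \<le> 1 / real (Suc n)" for n x using close j unfolding g_def by blast
    show "(\<lambda>n. 1 / real (Suc n)) \<longlonglongrightarrow> 0" by (rule lim_1_over_n[THEN LIMSEQ_Suc])
  qed (use j K(3) gC0 assms(4) in auto)
  then have "(\<lambda>n. Re (\<Sum>j\<in>J. \<mu> j (g n j))) \<longlonglongrightarrow> Re (\<Sum>j\<in>J. \<mu> j (f j))"
    by (intro tendsto_intros)
  moreover have "0 \<le> Re (\<Sum>j\<in>J. \<mu> j (g n j))" for n
  proof -
    have "(\<Sum>j\<in>J. \<mu> j (g n j)) = (\<Sum>i\<in>I n. \<Sum>j\<in>J. \<mu> j (\<lambda>x. complex_of_real (\<phi> n i x)) * f j i)"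
      by (subst sum.swap) (simp add: gval)
    moreover have "0 \<le> Re (\<Sum>i\<in>I n. \<Sum>j\<in>J. \<mu> j (\<lambda>x. complex_of_real (\<phi> n i x)) * f j i)"
      unfolding Re_sum[of _ "I n"] by (intro sum_nonneg pos \<phi>) (use a in auto)
    ultimately show ?thesis by simp
  qed
  ultimately show ?thesis by (intro LIMSEQ_le_const) auto
qed

lemma powr_lipschitz:
  fixes a b :: real
  assumes "0 \<le> a" "0 \<le> b" "a \<le> M" "b \<le> M" "q \<ge> 1"
  shows "\<bar>a powr q - b powr q\<bar> \<le> q * M powr (q - 1) * \<bar>a - b\<bar>"
proof -
  have *: "b powr q - a powr q \<le> q * M powr (q - 1) * (b - a)" if "a < b" "0 \<le> a" "b \<le> M" for a b
  proof -
    have "continuous_on {a..b} (\<lambda>x. x powr q)"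
      using that assms(5) by (intro continuous_on_powr' continuous_intros) auto
    moreover have "((\<lambda>x. x powr q) has_real_derivative q * x powr (q - 1)) (at x)" if "a < x" for x
      using that \<open>0 \<le> a\<close> by (intro has_real_derivative_powr) simp
    ultimately have "\<exists>l z. a < z \<and> z < b \<and> ((\<lambda>x. x powr q) has_real_derivative l) (at z) \<and>
        b powr q - a powr q = (b - a) * l"
      using MVT[of a b "\<lambda>x. x powr q"] that(1) real_differentiable_def by blast
    then obtain l z where z: "a < z" "z < b" "((\<lambda>x. x powr q) has_real_derivative l) (at z)"
        "b powr q - a powr q = (b - a) * l" by blast
    have "l = q * z powr (q - 1)"
      by (rule DERIV_unique[OF z(3) has_real_derivative_powr]) (use z that in simp)
    moreover have "z powr (q - 1) \<le> M powr (q - 1)"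
      using z that assms(5) by (intro powr_mono2) auto
    ultimately show ?thesis using that assms(5)
      using z(4) by (simp add: mult.commute mult_left_mono)
  qed
  show ?thesis
    using *[of a b] *[of b a] powr_mono2[of q a b] powr_mono2[of q b a] assms
    by (cases a b rule: linorder_cases) (auto simp: abs_if)
qed

text \<open>The root \<open>s = \<phi> powr (1 / q)\<close> is continuous but perhaps not
  differentiable. Uniform \<open>C1\<close> approximations \<open>w n\<close> of \<open>s\<close>
  satisfy \<open>\<bar>w n\<bar> powr q \<longlonglongrightarrow> \<phi>\<close> uniformly by the
  Lipschitz bound, with supports in one compact set.\<close>

lemma dual_nonneg_from_powers:
  fixes \<Omega> :: "(real^'n) set"
  assumes "open \<Omega>" "\<mu> \<in> C0_dual \<Omega>" "q \<ge> 1"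
    and pow: "\<And>w g. C1 w g \<Longrightarrow> (\<lambda>x. complex_of_real (w x)) \<in> C0 \<Omega> \<Longrightarrow>
       0 \<le> Re (\<mu> (\<lambda>x. complex_of_real (\<bar>w x\<bar> powr q)))"
    and \<phi>: "(\<lambda>x. complex_of_real (\<phi> x)) \<in> C0 \<Omega>" "\<And>x. 0 \<le> \<phi> x"
  shows "0 \<le> Re (\<mu> (\<lambda>x. complex_of_real (\<phi> x)))"
proof -
  define s where "s x = \<phi> x powr (1 / q)" for x
  have \<phi>c: "continuous_on UNIV \<phi>"
    using continuous_on_Re[OF C0_continuous[OF assms(1) \<phi>(1)]] by simp
  obtain S where S: "compact S" "S \<subseteq> \<Omega>" "\<And>x. complex_of_real (\<phi> x) \<noteq> 0 \<Longrightarrow> x \<in> S"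
    by (rule C0_supportE[OF \<phi>(1)]) (rule that)
  have sc: "continuous_on UNIV s" unfolding s_def
    using \<phi>(2) assms(3) by (intro continuous_on_powr' \<phi>c continuous_intros) auto
  have sC0: "(\<lambda>x. complex_of_real (s x)) \<in> C0 \<Omega>"
    by (rule C0I[OF _ S(1,2)]) (use S(3) sc in \<open>auto simp: s_def intro!: continuous_intros\<close>)
  have sq: "s x powr q = \<phi> x" for x using \<phi>(2)[of x] assms(3) by (simp add: s_def powr_powr)
  obtain B where B: "B > 0" "\<And>x. cmod (complex_of_real (s x)) \<le> B"
    by (rule C0_bounded[OF assms(1) sC0]) (rule that)
  obtain K I \<psi> where K: "compact K" "K \<subseteq> \<Omega>" "\<forall>j\<in>{()}. \<forall>x. complex_of_real (s x) \<noteq> 0 \<longrightarrow> x \<in> K"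
    and bumps: "\<forall>n. C1_bumps K (I n) (\<psi> n)"
    and close: "\<forall>n. \<forall>j\<in>{()}. \<forall>x. cmod ((\<Sum>i\<in>I n. complex_of_real (\<psi> n i x) * complex_of_real (s i)) - complex_of_real (s x)) \<le> 1 / real (Suc n)"
    by (rule C0_approximation[OF assms(1), of "{()}" "\<lambda>_ x. complex_of_real (s x)"]) (simp, rule sC0, rule that)
  have a: "finite (I n) \<and> (\<forall>i\<in>I n. (\<exists>g. C1 (\<psi> n i) g) \<and> (\<forall>x. \<psi> n i x \<ge> 0) \<and>
      (\<forall>x. \<psi> n i x \<noteq> 0 \<longrightarrow> x \<in> K))" for n
    using bumps by (simp add: C1_bumps_def)
  define w where "w n x = (\<Sum>i\<in>I n. \<psi> n i x * s i)" for n x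
  have w: "(\<exists>g. C1 (w n) g) \<and> (\<forall>x. w n x \<noteq> 0 \<longrightarrow> x \<in> K) \<and> (\<forall>x. \<bar>w n x - s x\<bar> \<le> 1 / real (Suc n))" for n
  proof (intro conjI allI impI)
    have "\<forall>i\<in>I n. \<exists>g. C1 (\<psi> n i) g" using a by blast
    then obtain g where "\<forall>i\<in>I n. C1 (\<psi> n i) (g i)" by (rule bchoice[THEN exE])
    then have "C1 (w n) (\<lambda>k x. \<Sum>i\<in>I n. \<psi> n i x * 0 + g i k x * s i)"
      unfolding w_def by (intro C1_sum C1_mult C1_const) auto
    then show "\<exists>g. C1 (w n) g" by blast
    fix x
    have "complex_of_real (w n x - s x) =
        (\<Sum>i\<in>I n. complex_of_real (\<psi> n i x) * complex_of_real (s i)) - complex_of_real (s x)"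
      by (simp add: w_def)
    then show "\<bar>w n x - s x\<bar> \<le> 1 / real (Suc n)" using close by (metis norm_of_real singletonI)
    show "x \<in> K" if "w n x \<noteq> 0"
    proof -
      have "\<exists>i\<in>I n. \<psi> n i x * s i \<noteq> 0"
        using that unfolding w_def by (rule contrapos_np) (simp add: sum.neutral)
      then show ?thesis using a by auto
    qed
  qed
  have wc: "continuous_on UNIV (w n)" for n using w by (auto simp: C1_def)
  have wC0: "(\<lambda>x. complex_of_real (w n x)) \<in> C0 \<Omega>" for n
    by (rule C0I[OF _ K(1,2)]) (use w wc in \<open>auto intro!: continuous_intros\<close>)
  have "(\<lambda>n. \<mu> (\<lambda>x. complex_of_real (\<bar>w n x\<bar> powr q))) \<longlonglongrightarrow> \<mu> (\<lambda>x. complex_of_real (\<phi> x))"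
  proof (rule dual_tendsto[OF assms(1,2) K(1,2)])
    have "continuous_on UNIV (\<lambda>x. \<bar>w n x\<bar> powr q)" for n
      using wc assms(3) by (intro continuous_on_powr' continuous_intros) auto
    then show "(\<lambda>x. complex_of_real (\<bar>w n x\<bar> powr q)) \<in> C0 \<Omega>" for n
      by (intro C0I[OF _ K(1,2)]) (use w in \<open>auto intro!: continuous_intros\<close>)
    show "x \<in> K" if "complex_of_real (\<bar>w n x\<bar> powr q) \<noteq> 0" for n x using that w by auto
    show "x \<in> K" if "complex_of_real (\<phi> x) \<noteq> 0" for x
      using K(3) that by (auto simp: s_def)
    \<comment> \<open>Both \<open>\<bar>w n x\<bar>\<close> and \<open>s x\<close> are at most
      \<open>B + 1\<close>, because \<open>w n\<close> differs from \<open>s\<close> by at most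
      1.\<close>
    show "cmod (complex_of_real (\<bar>w n x\<bar> powr q) - complex_of_real (\<phi> x))
        \<le> q * (B + 1) powr (q - 1) * (1 / real (Suc n))" for n x
    proof -
      have 1: "\<bar>w n x - s x\<bar> \<le> 1 / real (Suc n)" using w by blast
      also have "\<dots> \<le> 1" by simp
      finally have 2: "\<bar>w n x - s x\<bar> \<le> 1" .
      have s0: "0 \<le> s x" "s x \<le> B" using B(2)[of x] by (auto simp: s_def)
      have "cmod (complex_of_real (\<bar>w n x\<bar> powr q) - complex_of_real (\<phi> x)) = \<bar>\<bar>w n x\<bar> powr q - s x powr q\<bar>"
        unfolding sq by (metis norm_of_real of_real_diff)
      also have "\<dots> \<le> q * (B + 1) powr (q - 1) * \<bar>\<bar>w n x\<bar> - s x\<bar>"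
        using s0 2 assms(3) by (intro powr_lipschitz) auto
      also have "\<dots> \<le> q * (B + 1) powr (q - 1) * (1 / real (Suc n))"
        using assms(3) s0 1 by (intro mult_left_mono) auto
      finally show ?thesis .
    qed
    show "(\<lambda>n. q * (B + 1) powr (q - 1) * (1 / real (Suc n))) \<longlonglongrightarrow> 0"
      using tendsto_mult_left[OF lim_1_over_n[THEN LIMSEQ_Suc]] by fastforce
  qed (use \<phi> in auto)
  then have "(\<lambda>n. Re (\<mu> (\<lambda>x. complex_of_real (\<bar>w n x\<bar> powr q)))) \<longlonglongrightarrow> Re (\<mu> (\<lambda>x. complex_of_real (\<phi> x)))"
    by (rule tendsto_Re)
  moreover have "0 \<le> Re (\<mu> (\<lambda>x. complex_of_real (\<bar>w n x\<bar> powr q)))" for n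
    using pow wC0 w by blast
  ultimately show ?thesis by (intro LIMSEQ_le_const) auto
qed

section \<open>The derivative of |u|^(q-2) u\<close>

text \<open>
  \<open>pow_deriv q u w\<close> is the derivative of \<open>|u|^(q-2) u\<close> when \<open>u\<close> has derivative \<open>w\<close>. The weight
  \<open>pow_weight\<close> differs from \<open>|u|^(q-2)\<close> only by avoiding the junk value \<open>0 powr 0 = 0\<close>.
\<close>

definition pow_weight :: "real \<Rightarrow> complex \<Rightarrow> real" where
  "pow_weight q u = (if q = 2 then 1 else cmod u powr (q - 2))"

definition pow_deriv :: "real \<Rightarrow> complex \<Rightarrow> complex \<Rightarrow> complex" where
  "pow_deriv q u w = of_real (pow_weight q u) * w +
     of_real ((q - 2) * cmod u powr (q - 4) * Re (cnj u * w)) * u"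

text \<open>The derivative of \<open>|u|^(q-2) u\<close> at \<open>u = 1\<close> in direction
  \<open>z\<close>: the radial component is multiplied by \<open>q - 1\<close>, the tangential one
  is kept. It is linear over the reals only, so phases must be rotated away before it is
  applied.\<close>

definition stretch :: "real \<Rightarrow> complex \<Rightarrow> complex" where
  "stretch q z = z + of_real ((q - 2) * Re z)"

lemma stretch_sel [simp]: "Re (stretch q z) = (q - 1) * Re z" "Im (stretch q z) = Im z"
  by (simp_all add: stretch_def algebra_simps)

text \<open>Away from zeros the modulus is a power of the positive differentiable \<open>N\<close>,
  and the product rule applies. At a zero with \<open>q > 2\<close> the factor
  \<open>|g|^(q-2)\<close> tends to 0 while the difference quotients of \<open>g\<close> converge,
  so the derivative is 0; for \<open>q = 2\<close> the function is \<open>g\<close> itself.\<close>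

lemma pow_mult_has_vector_derivative:
  assumes "q \<ge> 2" "(g has_vector_derivative w) (at t)"
  shows "((\<lambda>t. of_real (cmod (g t) powr (q - 2)) * g t) has_vector_derivative pow_deriv q (g t) w) (at t)"
proof (cases "g t = 0")
  case False
  define N where "N s = (Re (g s))\<^sup>2 + (Im (g s))\<^sup>2" for s
  have Nt: "N t = (cmod (g t))\<^sup>2" "N t > 0" using False by (auto simp: N_def cmod_power2 sum_power2_gt_zero_iff complex_eq_iff)
  have pw: "cmod z powr r = ((Re z)\<^sup>2 + (Im z)\<^sup>2) powr (r / 2)" for z r
    by (simp add: cmod_def powr_half_sqrt[symmetric] powr_powr)
  have "((\<lambda>s. Re (g s)) has_real_derivative Re w) (at t)" "((\<lambda>s. Im (g s)) has_real_derivative Im w) (at t)"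
    using assms(2) by (auto simp: has_vector_derivative_complex_iff)
  from DERIV_add[OF DERIV_power[OF this(1), of 2] DERIV_power[OF this(2), of 2]]
  have "(N has_real_derivative 2 * Re (cnj (g t) * w)) (at t)"
    unfolding N_def by (rule DERIV_cong) (simp add: algebra_simps)
  from DERIV_chain2[OF has_real_derivative_powr[OF Nt(2), of "(q - 2) / 2"] this]
  have "((\<lambda>s. N s powr ((q - 2) / 2)) has_real_derivative
      (q - 2) * cmod (g t) powr (q - 4) * Re (cnj (g t) * w)) (at t)"
    by (rule DERIV_cong) (simp add: pw N_def field_simps)
  then have "((\<lambda>s. cmod (g s) powr (q - 2)) has_real_derivative
      (q - 2) * cmod (g t) powr (q - 4) * Re (cnj (g t) * w)) (at t)"
    unfolding N_def pw[symmetric] .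
  from has_vector_derivative_mult[OF has_vector_derivative_of_real[OF this] assms(2)]
  moreover have "pow_weight q (g t) = cmod (g t) powr (q - 2)"
    using False by (simp add: pow_weight_def)
  ultimately show ?thesis by (simp only: pow_deriv_def)
next
  case True
  show ?thesis
  proof (cases "q = 2")
    case 2: True
    have "(\<lambda>t. of_real (cmod (g t) powr (q - 2)) * g t) = g"
      by (rule ext) (simp add: 2)
    then show ?thesis using 2 assms(2) by (simp add: pow_deriv_def pow_weight_def)
  next
    case False
    have c: "((\<lambda>s. cmod (g s) powr (q - 2)) \<longlongrightarrow> 0) (at t)"
    proof -
      have "isCont g t" using assms(2) by (rule has_vector_derivative_continuous)
      then have "(g \<longlongrightarrow> 0) (at t)" using True by (simp add: isCont_def)
      then have "((\<lambda>s. cmod (g s) powr (q - 2)) \<longlongrightarrow> 0 powr (q - 2)) (at t)"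
        using False assms(1) by (intro tendsto_powr' tendsto_norm_zero tendsto_const) auto
      then show ?thesis by simp
    qed
    have *: "((\<lambda>s. cmod (g s) powr (q - 2) * h s) has_real_derivative 0) (at t)"
      if h: "(h has_real_derivative d) (at t)" "h t = 0" for h d
    proof -
      have "((\<lambda>s. (h s - h t) / (s - t)) \<longlongrightarrow> d) (at t)"
        using h(1) by (simp add: has_field_derivative_iff)
      from tendsto_mult[OF c this] show ?thesis
        using h(2) by (simp add: has_field_derivative_iff)
    qed
    have "((\<lambda>s. cmod (g s) powr (q - 2) * Re (g s)) has_real_derivative 0) (at t)"
      "((\<lambda>s. cmod (g s) powr (q - 2) * Im (g s)) has_real_derivative 0) (at t)"
      using assms(2) True by (auto intro!: * simp: has_vector_derivative_complex_iff)
    then have "((\<lambda>s. of_real (cmod (g s) powr (q - 2)) * g s) has_vector_derivative 0) (at t)"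
      by (simp add: has_vector_derivative_complex_iff)
    then show ?thesis using True False assms(1) by (simp add: pow_deriv_def pow_weight_def)
  qed
qed

text \<open>Near 0 the norm is \<open>cmod z powr (s + 1)\<close> with a positive exponent, so a
  negative \<open>s\<close> above -1 is harmless.\<close>

lemma continuous_on_powr_mult:
  assumes "s > -1"
  shows "continuous_on UNIV (\<lambda>z. complex_of_real (cmod z powr s) * z)"
  unfolding continuous_on_eq_continuous_at[OF open_UNIV]
proof
  fix z :: complex
  show "isCont (\<lambda>z. complex_of_real (cmod z powr s) * z) z"
  proof (cases "z = 0")
    case True
    have "((\<lambda>z. cmod z powr (s + 1)) \<longlongrightarrow> 0 powr (s + 1)) (at (0::complex))"
      using assms by (intro tendsto_powr' tendsto_norm_zero tendsto_const tendsto_ident_at) auto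
    then have "((\<lambda>z. cmod (complex_of_real (cmod z powr s) * z)) \<longlongrightarrow> 0) (at 0)"
      by (simp add: norm_mult powr_add)
    then have "((\<lambda>z. complex_of_real (cmod z powr s) * z) \<longlongrightarrow> 0) (at 0)"
      by (rule tendsto_norm_zero_cancel)
    then show ?thesis unfolding isCont_def True by (simp only: mult_zero_right)
  next
    case False
    then show ?thesis unfolding isCont_def
      by (intro tendsto_mult tendsto_of_real tendsto_powr tendsto_norm tendsto_const tendsto_ident_at) simp
  qed
qed

lemma continuous_on_pow_deriv:
  assumes "q \<ge> 2" "continuous_on UNIV u" "continuous_on UNIV w"
  shows "continuous_on UNIV (\<lambda>x. pow_deriv q (u x) (w x))"
proof (cases "q = 2")
  case True
  then show ?thesis using assms by (simp add: pow_deriv_def pow_weight_def)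
next
  case False
  \<comment> \<open>The factor \<open>|u|^(q-4)\<close> may be singular at zeros of
    \<open>u\<close>. It is split evenly between the two occurrences of \<open>u\<close>, and the
    resulting exponent \<open>q / 2 - 2\<close> exceeds -1 because \<open>q > 2\<close>.\<close>
  define P where "P z = complex_of_real (cmod z powr (q / 2 - 2)) * z" for z
  have "continuous_on UNIV P" unfolding P_def using False assms(1) by (intro continuous_on_powr_mult) auto
  then have "continuous_on UNIV (\<lambda>x. P (u x))" using assms(2) by (rule continuous_on_compose2) auto
  moreover have "continuous_on UNIV (\<lambda>x. cmod (u x) powr (q - 2))"
    using False assms by (intro continuous_on_powr' continuous_intros) auto
  moreover have "pow_deriv q z v = of_real (cmod z powr (q - 2)) * v + of_real ((q - 2) * Re (cnj (P z) * v)) * P z" for z v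
  proof -
    have "cmod z powr (q - 4) = cmod z powr (q / 2 - 2) * cmod z powr (q / 2 - 2)"
      by (simp flip: powr_add)
    then show ?thesis using False by (simp add: pow_deriv_def pow_weight_def P_def algebra_simps)
  qed
  ultimately show ?thesis using assms by (auto intro!: continuous_intros)
qed

text \<open>The phase \<open>e = cnj u / |u|\<close> rotates \<open>u\<close> onto the positive
  axis, where the derivative is \<open>stretch\<close> up to the factor \<open>|u|^(q-2)\<close>. At
  \<open>u = 0\<close> the phase 1 will do: for \<open>q > 2\<close> both sides vanish, for
  \<open>q = 2\<close> \<open>stretch\<close> is the identity.\<close>

lemma pow_deriv_polar:
  assumes "q \<ge> 2"
  obtains c e where "c \<ge> 0" "cmod e = 1" "\<And>w. pow_deriv q u w = of_real c * cnj e * stretch q (e * w)"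
proof (cases "u = 0")
  case True
  show thesis
  proof (rule that[of "pow_weight q 0" 1])
    show "pow_deriv q u w = of_real (pow_weight q 0) * cnj 1 * stretch q (1 * w)" for w
      using True assms by (simp add: pow_deriv_def pow_weight_def stretch_def)
  qed (simp_all add: pow_weight_def)
next
  case False
  define r where "r = cmod u"
  have r: "r > 0" using False by (simp add: r_def)
  have uu: "cnj u * u = of_real (r * r)" by (metis complex_norm_square mult.commute of_real_power power2_eq_square r_def)
  show thesis
  proof (rule that[of "r powr (q - 2)" "cnj u / of_real r"])
    show "cmod (cnj u / of_real r) = 1" using r by (simp add: norm_divide r_def)
    fix w
    have a: "r powr (q - 2) = r powr (q - 4) * (r * r)"
      using powr_add[of r "q - 4" 2] r by (simp add: power2_eq_square)
    have b: "Re (cnj u / of_real r * w) = Re (cnj u * w) / r"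
      by (simp add: field_simps add_divide_distrib)
    have c: "cnj (cnj u / of_real r) = u / of_real r"
      by simp
    have d: "u / of_real r * (cnj u / of_real r * w) = w"
      using r uu by (simp add: field_simps)
    define R where "R = Re (cnj u * w)"
    have H: "of_real (r powr (q - 2)) * (u / of_real r) * of_real ((q - 2) * (R / r)) = of_real ((q - 2) * r powr (q - 4) * R) * u"
      unfolding a using r by (simp add: field_simps)
    have pw: "pow_weight q u = r powr (q - 2)" using False by (simp add: pow_weight_def r_def)
    have "of_real (r powr (q - 2)) * (u / of_real r) * (cnj u / of_real r * w + of_real ((q - 2) * (R / r)))
        = of_real (r powr (q - 2)) * (u / of_real r * (cnj u / of_real r * w))
          + of_real (r powr (q - 2)) * (u / of_real r) * of_real ((q - 2) * (R / r))"
      by (simp only: distrib_left mult.assoc)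
    also have "\<dots> = of_real (r powr (q - 2)) * w + of_real ((q - 2) * r powr (q - 4) * R) * u"
      by (simp only: d H)
    finally show "pow_deriv q u w = of_real (r powr (q - 2)) * cnj (cnj u / of_real r) * stretch q (cnj u / of_real r * w)"
      unfolding pow_deriv_def stretch_def b c pw R_def r_def[symmetric] by simp
  qed simp
qed

section \<open>Sufficiency of the algebraic condition\<close>

text \<open>Off its closed support \<open>u\<close> vanishes on a neighbourhood, so the derivative
  exists outside \<Omega> as well and is 0 there. Hence \<open>partial k u\<close> is supported
  inside the support of \<open>u\<close>.\<close>

lemma C01_partial:
  assumes "open \<Omega>" "u \<in> C01 \<Omega>"
  shows "((\<lambda>t. u (x + t *\<^sub>R axis k 1)) has_vector_derivative partial k u x) (at 0)"
    and "partial k u \<in> C0 \<Omega>"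
proof -
  let ?S = "closure {x. u x \<noteq> 0}"
  have S: "compact ?S" "?S \<subseteq> \<Omega>" and u: "u \<in> C0 \<Omega>" "continuous_on \<Omega> (partial k u)"
    using assms(2) by (auto simp: C01_def C0_def)
  have out: "((\<lambda>t. u (x + t *\<^sub>R axis k 1)) has_vector_derivative 0) (at 0)" if "x \<notin> ?S" for x
  proof -
    have "continuous_on UNIV (\<lambda>t. x + t *\<^sub>R axis k (1::real))" by (intro continuous_intros)
    then have T: "open ((\<lambda>t. x + t *\<^sub>R axis k (1::real)) -` (- ?S))" (is "open ?T")
      by (intro open_vimage) auto
    have T0: "0 \<in> ?T" using that by simp
    have "u (x + t *\<^sub>R axis k 1) = 0" if "t \<in> ?T" for t
    proof (rule ccontr)
      assume "u (x + t *\<^sub>R axis k 1) \<noteq> 0"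
      then have "x + t *\<^sub>R axis k 1 \<in> ?S" by (intro subsetD[OF closure_subset]) simp
      then show False using that by simp
    qed
    then show ?thesis
      by (intro has_vector_derivative_transform_within_open[OF has_vector_derivative_const T T0]) simp
  qed
  then have zero: "partial k u x = 0" if "x \<notin> ?S" for x
    unfolding partial_def using that by (intro vector_derivative_at) auto
  show "((\<lambda>t. u (x + t *\<^sub>R axis k 1)) has_vector_derivative partial k u x) (at 0)"
  proof (cases "x \<in> \<Omega>")
    case True
    then have "(\<lambda>t. u (x + t *\<^sub>R axis k 1)) differentiable at 0" using assms(2) by (auto simp: C01_def)
    then show ?thesis unfolding partial_def by (simp add: vector_derivative_works)
  next
    case False
    then have "x \<notin> ?S" using S by blast
    then show ?thesis using out zero by simp
  qed
  have sub: "closure {x. partial k u x \<noteq> 0} \<subseteq> ?S"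
    using zero by (intro closure_minimal) auto
  then have "compact (closure {x. partial k u x \<noteq> 0})"
    using compact_Int_closed[OF S(1), of "closure {x. partial k u x \<noteq> 0}"] by (simp add: Int_absorb1)
  then show "partial k u \<in> C0 \<Omega>" using sub S(2) u(2) by (simp add: C0_def)
qed

lemma partial_pow_mult:
  assumes "open \<Omega>" "u \<in> C01 \<Omega>" "q \<ge> 2"
  shows "partial k (pow_mult q u) x = pow_deriv q (u x) (partial k u x)"
  using pow_mult_has_vector_derivative[OF assms(3) C01_partial(1)[OF assms(1,2)], of x k]
  unfolding partial_def[of k "pow_mult q u"] pow_mult_def by (intro vector_derivative_at) simp

text \<open>The pointwise core: \<open>R\<close> and \<open>I\<close> stand for the numbers that the
  real and imaginary parts of the measures assign to one test function, and \<open>z\<close> for the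
  gradient after rotation of the phase.\<close>

lemma stretch_form_nonneg:
  fixes R I :: "'n::finite \<Rightarrow> 'n \<Rightarrow> real" and z :: "'n \<Rightarrow> complex"
  assumes "q \<ge> 2" "\<And>h k. I h k = I k h"
    and cond: "\<And>\<xi> :: 'n \<Rightarrow> real. (q - 2) * \<bar>\<Sum>h\<in>UNIV. \<Sum>k\<in>UNIV. \<xi> k * \<xi> h * I h k\<bar>
        \<le> 2 * sqrt (q - 1) * (\<Sum>h\<in>UNIV. \<Sum>k\<in>UNIV. \<xi> k * \<xi> h * R h k)"
  shows "0 \<le> Re (\<Sum>h\<in>UNIV. \<Sum>k\<in>UNIV. Complex (R h k) (I h k) * (z k * cnj (stretch q (z h))))"
proof -
  define b where "b M x y = (\<Sum>h\<in>UNIV. \<Sum>k\<in>UNIV. x k * y h * M h k)"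
    for M :: "'n \<Rightarrow> 'n \<Rightarrow> real" and x y :: "'n \<Rightarrow> real"
  define s where "s = sqrt (q - 1)"
  have s: "s > 0" "s * s = q - 1" using assms(1) by (auto simp: s_def)
  define X Y where "X k = Re (z k)" and "Y k = Im (z k)" for k
  have b_comb: "b M (\<lambda>k. \<alpha> * x k + \<beta> * x' k) (\<lambda>k. \<gamma> * y k + \<delta> * y' k)
      = \<alpha> * \<gamma> * b M x y + \<alpha> * \<delta> * b M x y' + \<beta> * \<gamma> * b M x' y + \<beta> * \<delta> * b M x' y'" for M \<alpha> x \<beta> x' \<gamma> y \<delta> y'
    unfolding b_def sum_distrib_left sum.distrib[symmetric] by (intro sum.cong refl) (simp add: algebra_simps)
  have sym: "b I x y = b I y x" for x y
    unfolding b_def by (subst sum.swap) (use assms(2) in \<open>simp add: mult.commute\<close>)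
  have "Re (\<Sum>h\<in>UNIV. \<Sum>k\<in>UNIV. Complex (R h k) (I h k) * (z k * cnj (stretch q (z h))))
      = (q - 1) * b R X X + b R Y Y - ((q - 1) * b I Y X - b I X Y)"
    unfolding b_def sum_distrib_left sum_subtractf[symmetric] sum.distrib[symmetric] Re_sum X_def Y_def
    by (intro sum.cong refl) (simp add: algebra_simps)
  also have "\<dots> = (q - 1) * b R X X + b R Y Y - (q - 2) * b I X Y"
    by (simp add: sym[of Y X] algebra_simps)
  finally have Re: "Re (\<Sum>h\<in>UNIV. \<Sum>k\<in>UNIV. Complex (R h k) (I h k) * (z k * cnj (stretch q (z h))))
      = (q - 1) * b R X X + b R Y Y - (q - 2) * b I X Y" .
  \<comment> \<open>Polarisation: in \<open>b I U U - b I V V\<close> the diagonal terms cancel and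
    leave \<open>4 * s * b I X Y\<close>, while in \<open>b R U U + b R V V\<close> the mixed terms
    cancel. The coefficients 1 and -1 are written out to match \<open>b_comb\<close>.\<close>
  define U V where "U k = s * X k + 1 * Y k" and "V k = s * X k + (-1) * Y k" for k
  have "(q - 2) * \<bar>b I U U\<bar> \<le> 2 * s * b R U U" "(q - 2) * \<bar>b I V V\<bar> \<le> 2 * s * b R V V"
    using cond unfolding b_def s_def by blast+
  moreover have "(q - 2) * b I U U \<le> (q - 2) * \<bar>b I U U\<bar>" "(q - 2) * (- b I V V) \<le> (q - 2) * \<bar>b I V V\<bar>"
    using assms(1) by (intro mult_left_mono; simp)+
  ultimately have "(q - 2) * (b I U U - b I V V) \<le> 2 * s * (b R U U + b R V V)"
    by (simp add: algebra_simps)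
  moreover have "b I U U - b I V V = 4 * s * b I X Y"
    unfolding U_def V_def b_comb using sym[of X Y] by (simp add: algebra_simps)
  moreover have "b R U U + b R V V = 2 * ((q - 1) * b R X X + b R Y Y)"
    unfolding U_def V_def b_comb s(2)[symmetric] by (simp add: algebra_simps)
  ultimately have "4 * s * ((q - 2) * b I X Y) \<le> 4 * s * ((q - 1) * b R X X + b R Y Y)"
    by (simp add: algebra_simps)
  then have "(q - 2) * b I X Y \<le> (q - 1) * b R X X + b R Y Y"
    using s(1) by simp
  then show ?thesis unfolding Re by simp
qed

text \<open>The criterion of the theorem in the case \<open>q \<ge> 2\<close>, with the total
  variation replaced by the modulus of the number assigned to each \<phi>.
  \<open>total_variation_le_iff\<close> shows that this replacement loses nothing.\<close>

definition algebraic_condition :: "(real^'n) set \<Rightarrow> real \<Rightarrow> 'n functional^'n^'n \<Rightarrow> bool" where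
  "algebraic_condition \<Omega> q A \<longleftrightarrow> (\<forall>\<xi> :: real^'n. \<forall>\<phi>.
     (\<lambda>x. complex_of_real (\<phi> x)) \<in> C0 \<Omega> \<and> (\<forall>x. 0 \<le> \<phi> x) \<longrightarrow>
       (q - 2) * \<bar>\<Sum>h\<in>UNIV. \<Sum>k\<in>UNIV. \<xi> $ k * \<xi> $ h * Im ((A $ h $ k) (\<lambda>x. complex_of_real (\<phi> x)))\<bar>
       \<le> 2 * sqrt (q - 1) * (\<Sum>h\<in>UNIV. \<Sum>k\<in>UNIV. \<xi> $ k * \<xi> $ h * Re ((A $ h $ k) (\<lambda>x. complex_of_real (\<phi> x)))))"

text \<open>\<open>dual_pos\<close>, indexed by the pairs \<open>(h, k)\<close>, freezes the
  gradient of \<open>u\<close> at a point. What remains is a statement about the numbers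
  \<open>a h k\<close>, to which \<open>stretch_form_nonneg\<close> applies.\<close>

lemma dissipative_of_algebraic_condition:
  fixes A :: "'n functional^'n^'n"
  assumes "open \<Omega>" "q \<ge> 2" "\<And>h k. A $ h $ k \<in> C0_dual \<Omega>"
    and sym: "\<And>h k \<phi>. (\<lambda>x. complex_of_real (\<phi> x)) \<in> C0 \<Omega> \<Longrightarrow>
       Im ((A $ h $ k) (\<lambda>x. complex_of_real (\<phi> x))) = Im ((A $ k $ h) (\<lambda>x. complex_of_real (\<phi> x)))"
    and cond: "algebraic_condition \<Omega> q A" and u: "u \<in> C01 \<Omega>"
  shows "0 \<le> Re (sesq_form A u (pow_mult q u))"
proof -
  define f where "f = (\<lambda>(h, k) x. partial k u x * cnj (pow_deriv q (u x) (partial h u x)))"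
  have uC0: "u \<in> C0 \<Omega>" using u by (simp add: C01_def)
  have fC0: "f j \<in> C0 \<Omega>" for j
  proof -
    obtain h k where j: "j = (h, k)" by (cases j)
    have "continuous_on UNIV (\<lambda>x. cnj (pow_deriv q (u x) (partial h u x)))"
      by (intro continuous_on_cnj continuous_on_pow_deriv assms(2) C0_continuous[OF assms(1)]
          uC0 C01_partial(2)[OF assms(1) u])
    from C0_mult_continuous[OF assms(1) C01_partial(2)[OF assms(1) u] this, of k]
    show ?thesis by (simp add: f_def j)
  qed
  have "sesq_form A u (pow_mult q u) = (\<Sum>j\<in>UNIV. (A $ fst j $ snd j) (f j))"
    unfolding sesq_form_def partial_pow_mult[OF assms(1) u assms(2)]
    by (simp add: f_def sum.cartesian_product case_prod_unfold)
  also have "0 \<le> Re \<dots>"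
  proof (rule dual_pos[OF assms(1), where \<mu> = "\<lambda>j. A $ fst j $ snd j" and f = f])
    fix \<phi> :: "real^'n \<Rightarrow> real" and x
    assume \<phi>: "(\<lambda>x. complex_of_real (\<phi> x)) \<in> C0 \<Omega>" "\<forall>x. 0 \<le> \<phi> x"
    define a where "a h k = (A $ h $ k) (\<lambda>x. complex_of_real (\<phi> x))" for h k
    obtain c e where ce: "c \<ge> 0" "cmod e = 1"
      "\<And>w. pow_deriv q (u x) w = of_real c * cnj e * stretch q (e * w)"
      by (rule pow_deriv_polar[OF assms(2)]) (rule that)
    define z where "z k = e * partial k u x" for k
    \<comment> \<open>Conjugation turns \<open>cnj e\<close> into \<open>e\<close>, which is
      absorbed by \<open>partial k u x\<close>; the phase does not depend on \<open>h\<close> and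
      \<open>k\<close>.\<close>
    have "partial k u x * cnj (pow_deriv q (u x) (partial h u x)) = of_real c * (z k * cnj (stretch q (z h)))" for h k
      by (simp add: ce(3) z_def)
    then have "(\<Sum>j\<in>UNIV. (A $ fst j $ snd j) (\<lambda>y. complex_of_real (\<phi> y)) * f j x)
        = (\<Sum>h\<in>UNIV. \<Sum>k\<in>UNIV. a h k * (of_real c * (z k * cnj (stretch q (z h)))))"
      by (simp add: f_def sum.cartesian_product case_prod_unfold a_def)
    also have "\<dots> = of_real c * (\<Sum>h\<in>UNIV. \<Sum>k\<in>UNIV. Complex (Re (a h k)) (Im (a h k)) * (z k * cnj (stretch q (z h))))"
      by (simp add: sum_distrib_left mult_ac)
    finally have eq: "(\<Sum>j\<in>UNIV. (A $ fst j $ snd j) (\<lambda>y. complex_of_real (\<phi> y)) * f j x) = \<dots>" .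
    have "0 \<le> Re (\<Sum>h\<in>UNIV. \<Sum>k\<in>UNIV. Complex (Re (a h k)) (Im (a h k)) * (z k * cnj (stretch q (z h))))"
    proof (rule stretch_form_nonneg[OF assms(2)])
      show "Im (a h k) = Im (a k h)" for h k unfolding a_def by (rule sym[OF \<phi>(1)])
      show "(q - 2) * \<bar>\<Sum>h\<in>UNIV. \<Sum>k\<in>UNIV. \<xi> k * \<xi> h * Im (a h k)\<bar>
        \<le> 2 * sqrt (q - 1) * (\<Sum>h\<in>UNIV. \<Sum>k\<in>UNIV. \<xi> k * \<xi> h * Re (a h k))" for \<xi>
        using cond[unfolded algebraic_condition_def, rule_format, OF conjI[OF \<phi>(1)], of "\<chi> k. \<xi> k"] \<phi>(2)
        by (simp add: a_def)
    qed
    then have "0 \<le> c * Re (\<Sum>h\<in>UNIV. \<Sum>k\<in>UNIV. Complex (Re (a h k)) (Im (a h k)) * (z k * cnj (stretch q (z h))))"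
      by (rule mult_nonneg_nonneg[OF ce(1)])
    then show "0 \<le> Re (\<Sum>j\<in>UNIV. (A $ fst j $ snd j) (\<lambda>y. complex_of_real (\<phi> y)) * f j x)"
      unfolding eq by simp
  qed (use assms(3) fC0 in auto)
  finally show ?thesis .
qed

section \<open>Necessity: oscillating test functions\<close>

lemma C1_inner: "C1 (\<lambda>x. \<xi> \<bullet> x) (\<lambda>k x. \<xi> $ k)"
  by (auto simp: C1_def inner_add_right inner_axis intro!: continuous_intros derivative_eq_intros)

text \<open>Amplitude \<open>1 / N\<close> at frequency of order \<open>N\<^sup>2\<close>: the
  function tends to 0 uniformly while its gradient grows like \<open>N\<close>.\<close>

lemma C1_oscillation:
  assumes "N \<noteq> 0"
  shows "C1 (\<lambda>x. sin (N\<^sup>2 * (\<xi> \<bullet> x) + \<theta>) / N) (\<lambda>k x. N * cos (N\<^sup>2 * (\<xi> \<bullet> x) + \<theta>) * \<xi> $ k)"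
proof -
  have 1: "C1 (\<lambda>x. N\<^sup>2 * (\<xi> \<bullet> x) + \<theta>) (\<lambda>k x. N\<^sup>2 * \<xi> $ k)"
    using C1_add[OF C1_mult[OF C1_const[of "N\<^sup>2"] C1_inner[of \<xi>]] C1_const[of \<theta>]] by simp
  have "((\<lambda>y. sin y / N) has_real_derivative cos y / N) (at y)" for y
    using assms by (auto intro!: derivative_eq_intros)
  moreover have "continuous_on UNIV (\<lambda>y. cos y / N)" using assms by (intro continuous_intros) auto
  ultimately have "C1 (\<lambda>x. sin (N\<^sup>2 * (\<xi> \<bullet> x) + \<theta>) / N)
      (\<lambda>k x. cos (N\<^sup>2 * (\<xi> \<bullet> x) + \<theta>) / N * (N\<^sup>2 * \<xi> $ k))"
    by (rule C1_compose[OF 1])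
  then show ?thesis using assms by (simp add: power2_eq_square mult_ac)
qed

lemma modulated_partial:
  fixes \<kappa> :: complex
  assumes "C1 w w'" "C1 a a'"
  defines "u \<equiv> \<lambda>x. complex_of_real (w x) * exp (\<kappa> * complex_of_real (a x))"
  shows "((\<lambda>t. u (x + t *\<^sub>R axis k 1)) has_vector_derivative
      exp (\<kappa> * of_real (a x)) * (of_real (w' k x) + \<kappa> * of_real (w x * a' k x))) (at 0)"
proof -
  let ?l = "\<lambda>t. x + t *\<^sub>R axis k 1"
  have w: "((\<lambda>t. complex_of_real (w (?l t))) has_vector_derivative of_real (w' k x)) (at 0)"
    and a: "((\<lambda>t. complex_of_real (a (?l t))) has_vector_derivative of_real (a' k x)) (at 0)"
    using assms(1,2) by (auto simp: C1_def intro!: has_vector_derivative_of_real)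
  have "((\<lambda>t. \<kappa> * complex_of_real (a (?l t))) has_vector_derivative \<kappa> * of_real (a' k x)) (at 0)"
    using has_vector_derivative_mult[OF has_vector_derivative_const a] by simp
  from field_vector_diff_chain_at[OF this DERIV_exp]
  have "((\<lambda>t. exp (\<kappa> * complex_of_real (a (?l t)))) has_vector_derivative
      \<kappa> * of_real (a' k x) * exp (\<kappa> * of_real (a x))) (at 0)"
    by (simp add: o_def)
  from has_vector_derivative_mult[OF w this] show ?thesis
    unfolding u_def by (simp add: algebra_simps)
qed

lemma C01I:
  assumes "u \<in> C0 \<Omega>" "\<And>k x. ((\<lambda>t. u (x + t *\<^sub>R axis k 1)) has_vector_derivative u' k x) (at 0)"
    and "\<And>k. continuous_on UNIV (u' k)"
  shows "u \<in> C01 \<Omega>" "partial k u = u' k"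
proof -
  show p: "partial k u = u' k" for k
    unfolding partial_def by (rule ext, rule vector_derivative_at, rule assms(2))
  show "u \<in> C01 \<Omega>"
    using assms by (auto simp: C01_def p intro: continuous_on_subset differentiableI_vector)
qed

text \<open>Multiplying \<open>u\<close> by \<open>E\<close> multiplies \<open>|u|^(q-2) u\<close>
  by \<open>|E|^(q-2) E\<close>, which reduces the claim to a real value \<open>w\<close>. There the
  derivative is \<open>pow_weight\<close> times \<open>stretch\<close>, for either sign of
  \<open>w\<close>.\<close>

lemma pow_deriv_modulated:
  assumes "q \<ge> 2" "E \<noteq> 0"
  shows "pow_deriv q (of_real w * E) (E * z)
    = of_real (cmod E powr (q - 2) * pow_weight q (of_real w)) * E * stretch q z"
proof (cases "w = 0")
  case True
  then show ?thesis using assms by (simp add: pow_deriv_def pow_weight_def stretch_def)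
next
  case False
  have pw: "pow_weight q (of_real w * E) = cmod E powr (q - 2) * pow_weight q (of_real w)"
    using assms(2) by (simp add: pow_weight_def norm_mult powr_mult)
  have pw': "pow_weight q (of_real w) = \<bar>w\<bar> powr (q - 4) * (w * w)"
  proof -
    have "pow_weight q (of_real w) = \<bar>w\<bar> powr (q - 2)" using False by (simp add: pow_weight_def)
    then show ?thesis using powr_add[of "\<bar>w\<bar>" "q - 4" 2] by (simp add: power2_eq_square)
  qed
  have E: "cmod E powr (q - 2) = cmod E powr (q - 4) * (cmod E * cmod E)"
    using powr_add[of "cmod E" "q - 4" 2] assms(2) by (simp add: power2_eq_square)
  have "cnj E * E = of_real (cmod E * cmod E)"
    by (metis complex_norm_square mult.commute of_real_power power2_eq_square)
  then have "Re (cnj (of_real w * E) * (E * z)) = w * (cmod E * cmod E) * Re z"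
    by (metis (no_types, lifting) complex_cnj_complex_of_real complex_cnj_mult mult.assoc of_real_mult Re_complex_of_real times_complex.sel(1) Im_complex_of_real mult_zero_left diff_zero)
  moreover have "cmod (of_real w * E) powr (q - 4) = \<bar>w\<bar> powr (q - 4) * cmod E powr (q - 4)"
    by (simp add: norm_mult powr_mult)
  ultimately have "(q - 2) * cmod (of_real w * E) powr (q - 4) * Re (cnj (of_real w * E) * (E * z)) * w
      = cmod E powr (q - 2) * pow_weight q (of_real w) * ((q - 2) * Re z)"
    unfolding pw' E by (simp only: mult_ac)
  then have "complex_of_real ((q - 2) * cmod (of_real w * E) powr (q - 4) * Re (cnj (of_real w * E) * (E * z))) * (of_real w * E)
      = of_real (cmod E powr (q - 2) * pow_weight q (of_real w) * ((q - 2) * Re z)) * E"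
    by (metis mult.assoc of_real_mult)
  then show ?thesis
    unfolding pow_deriv_def pw stretch_def by (simp add: algebra_simps)
qed

lemma norm_stretch_le:
  assumes "q \<ge> 2" shows "cmod (stretch q z) \<le> q * cmod z"
proof -
  have "cmod (stretch q z) \<le> cmod z + \<bar>(q - 2) * Re z\<bar>"
    unfolding stretch_def by (metis norm_of_real norm_triangle_ineq)
  also have "\<dots> \<le> cmod z + (q - 2) * cmod z"
    using assms by (simp add: abs_mult mult_left_mono abs_Re_le_cmod)
  also have "\<dots> \<le> q * cmod z" using assms by (simp add: algebra_simps)
  finally show ?thesis .
qed

lemma stretch_diff: "stretch q z - stretch q w = stretch q (z - w)"
  by (simp add: stretch_def algebra_simps)

lemma stretch_scale: "stretch q (of_real r * z) = of_real r * stretch q z"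
  by (simp add: stretch_def algebra_simps)

text \<open>Telescoping: the exponential, the first and the second gradient factor are replaced by
  their limits one after the other. The bound tends to 0 with \<rho> and \<open>d\<close>.\<close>

lemma modulation_error:
  assumes q: "q \<ge> 2" and "d \<ge> 0" "C \<ge> 0" "cmod x0 \<le> C" "cmod y0 \<le> C"
    "cmod (x - x0) \<le> d" "cmod (y - y0) \<le> d" "\<bar>r\<bar> \<le> \<rho>"
  shows "cmod (of_real (exp r) * (x * cnj (stretch q y)) - x0 * cnj (stretch q y0))
    \<le> (exp \<rho> - 1) * ((C + d) * (q * (C + d))) + d * (q * (C + d)) + C * (q * d)"
proof -
  have x: "cmod x \<le> C + d" and y: "cmod y \<le> C + d"
    using assms norm_triangle_sub[of x x0] norm_triangle_sub[of y y0] by auto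
  have sy: "cmod (stretch q y) \<le> q * (C + d)"
    using norm_stretch_le[OF q, of y] y q by (smt (verit) mult_left_mono)
  have sd: "cmod (stretch q (y - y0)) \<le> q * d"
    using norm_stretch_le[OF q, of "y - y0"] assms by (smt (verit) mult_left_mono)
  \<comment> \<open>For negative \<open>r\<close> the chain is
    \<open>1 - exp r \<le> - r \<le> \<rho> \<le> exp \<rho> - 1\<close>.\<close>
  have e: "\<bar>exp r - 1\<bar> \<le> exp \<rho> - 1"
  proof (cases "r \<ge> 0")
    case False
    have "1 + r \<le> exp r" by (rule exp_ge_add_one_self)
    moreover have "1 + \<rho> \<le> exp \<rho>" by (rule exp_ge_add_one_self)
    moreover have "exp r < 1" using False by simp
    ultimately show ?thesis using False assms(8) by linarith
  qed (use assms(8) in simp)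
  have "of_real (exp r) * (x * cnj (stretch q y)) - x0 * cnj (stretch q y0)
     = of_real (exp r - 1) * (x * cnj (stretch q y)) + (x - x0) * cnj (stretch q y)
       + x0 * cnj (stretch q (y - y0))"
    by (simp add: stretch_diff[symmetric] algebra_simps)
  also have "cmod \<dots> \<le> cmod (of_real (exp r - 1) * (x * cnj (stretch q y)))
      + cmod ((x - x0) * cnj (stretch q y)) + cmod (x0 * cnj (stretch q (y - y0)))"
    by (intro order_trans[OF norm_triangle_ineq] add_right_mono norm_triangle_ineq)
  also have "\<dots> = \<bar>exp r - 1\<bar> * (cmod x * cmod (stretch q y)) + cmod (x - x0) * cmod (stretch q y)
      + cmod x0 * cmod (stretch q (y - y0))"
    unfolding norm_mult norm_of_real complex_mod_cnj ..
  also have "\<dots> \<le> (exp \<rho> - 1) * ((C + d) * (q * (C + d))) + d * (q * (C + d)) + C * (q * d)"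
    using e x sy sd assms by (intro add_mono mult_mono mult_nonneg_nonneg) auto
  finally show ?thesis .
qed

text \<open>The value is \<open>s * (2 * s + i \<sigma> (q - 2))\<close> with
  \<open>s = sqrt (q - 1)\<close>, which displays both constants of the criterion. For this \<kappa>
  one has \<open>X = \<xi>\<close> and \<open>Y = \<sigma> s \<xi>\<close>, so one of the
  polarisation vectors \<open>s X \<plusminus> Y\<close> vanishes: the test direction is the one in
  which the sufficiency argument is sharp.\<close>

lemma stretch_direction:
  assumes "\<sigma> * \<sigma> = 1" "q \<ge> 1"
  defines "\<kappa> \<equiv> Complex 1 (\<sigma> * sqrt (q - 1))"
  shows "\<kappa> * cnj (stretch q \<kappa>) = Complex (2 * (q - 1)) (\<sigma> * sqrt (q - 1) * (q - 2))"
proof -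
  have "(\<sigma> * sqrt (q - 1)) * (\<sigma> * sqrt (q - 1)) = (\<sigma> * \<sigma>) * (sqrt (q - 1) * sqrt (q - 1))"
    by (simp only: mult_ac)
  then have "(\<sigma> * sqrt (q - 1)) * (\<sigma> * sqrt (q - 1)) = q - 1" using assms(1,2) by simp
  then show ?thesis by (simp add: \<kappa>_def complex_eq_iff algebra_simps)
qed

lemma pow_weight_square: "q \<ge> 2 \<Longrightarrow> pow_weight q (of_real w) * (w * w) = \<bar>w\<bar> powr q"
  using powr_add[of "\<bar>w\<bar>" "q - 2" 2] by (auto simp: pow_weight_def power2_eq_square)

text \<open>
  For the test function \<open>u = w exp (\<kappa> a)\<close> with \<open>a x = sin (N\<^sup>2 \<langle>\<xi>, x\<rangle> + \<theta>) / N\<close>, the gradient is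
  \<open>N exp (\<kappa> a)\<close> times \<open>osc_grad\<close>, and \<open>\<partial>\<^sub>k u * cnj (\<partial>\<^sub>h (|u|^(q-2) u))\<close> is \<open>N\<^sup>2\<close> times \<open>osc_density\<close>.
\<close>

definition osc_grad ::
  "(real^'n \<Rightarrow> real) \<Rightarrow> ('n \<Rightarrow> real^'n \<Rightarrow> real) \<Rightarrow> real^'n \<Rightarrow> complex \<Rightarrow> real \<Rightarrow> real \<Rightarrow> 'n \<Rightarrow> real^'n \<Rightarrow> complex"
  where "osc_grad w w' \<xi> \<kappa> N \<theta> k x =
    of_real (w' k x / N) + \<kappa> * of_real (w x * cos (N\<^sup>2 * (\<xi> \<bullet> x) + \<theta>) * \<xi> $ k)"

definition osc_density ::
  "real \<Rightarrow> (real^'n \<Rightarrow> real) \<Rightarrow> ('n \<Rightarrow> real^'n \<Rightarrow> real) \<Rightarrow> real^'n \<Rightarrow> complex \<Rightarrow> real \<Rightarrow> real \<Rightarrow> 'n \<Rightarrow> 'n \<Rightarrow> real^'n \<Rightarrow> complex"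
  where "osc_density q w w' \<xi> \<kappa> N \<theta> h k x = of_real (pow_weight q (of_real (w x))) *
      (of_real (exp (q * (sin (N\<^sup>2 * (\<xi> \<bullet> x) + \<theta>) / N))) *
        (osc_grad w w' \<xi> \<kappa> N \<theta> k x * cnj (stretch q (osc_grad w w' \<xi> \<kappa> N \<theta> h x))))"

lemma sesq_form_oscillation:
  fixes A :: "'n functional^'n^'n"
  assumes "open \<Omega>" "q \<ge> 2" "\<And>h k. A $ h $ k \<in> C0_dual \<Omega>"
    and diss: "\<And>u. u \<in> C01 \<Omega> \<Longrightarrow> 0 \<le> Re (sesq_form A u (pow_mult q u))"
    and w: "C1 w w'" "(\<lambda>x. complex_of_real (w x)) \<in> C0 \<Omega>"
    and N: "N > 0" and \<kappa>: "Re \<kappa> = 1"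
  shows "\<And>h k. osc_density q w w' \<xi> \<kappa> N \<theta> h k \<in> C0 \<Omega>"
    and "0 \<le> Re (\<Sum>h\<in>UNIV. \<Sum>k\<in>UNIV. (A $ h $ k) (osc_density q w w' \<xi> \<kappa> N \<theta> h k))"
proof -
  define Z where "Z = osc_grad w w' \<xi> \<kappa> N \<theta>"
  define G where "G = osc_density q w w' \<xi> \<kappa> N \<theta>"
  have Z: "Z k x = of_real (w' k x / N) + \<kappa> * of_real (w x * cos (N\<^sup>2 * (\<xi> \<bullet> x) + \<theta>) * \<xi> $ k)" for k x
    by (simp add: Z_def osc_grad_def)
  have G: "G h k x = of_real (pow_weight q (of_real (w x))) *
      (of_real (exp (q * (sin (N\<^sup>2 * (\<xi> \<bullet> x) + \<theta>) / N))) * (Z k x * cnj (stretch q (Z h x))))" for h k x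
    by (simp add: G_def Z_def osc_density_def)
  define a where "a x = sin (N\<^sup>2 * (\<xi> \<bullet> x) + \<theta>) / N" for x
  define a' where "a' k x = N * cos (N\<^sup>2 * (\<xi> \<bullet> x) + \<theta>) * \<xi> $ k" for k x
  define E where "E x = exp (\<kappa> * complex_of_real (a x))" for x
  define u where "u x = complex_of_real (w x) * E x" for x
  have a: "C1 a a'" unfolding a_def a'_def using N by (intro C1_oscillation) simp
  have ac: "continuous_on UNIV a" "continuous_on UNIV (a' k)" and wc: "continuous_on UNIV w" "continuous_on UNIV (w' k)" for k
    using a w by (auto simp: C1_def)
  have Ec: "continuous_on UNIV E" unfolding E_def using ac by (intro continuous_intros)
  have uC0: "u \<in> C0 \<Omega>" unfolding u_def by (rule C0_mult_continuous[OF assms(1) w(2) Ec])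
  have du: "((\<lambda>t. u (x + t *\<^sub>R axis k 1)) has_vector_derivative E x * (of_real N * Z k x)) (at 0)" for k x
  proof -
    have "of_real (w' k x) + \<kappa> * of_real (w x * a' k x) = of_real N * Z k x"
      using N by (simp add: Z a'_def field_simps)
    then show ?thesis using modulated_partial[OF w(1) a, where \<kappa> = \<kappa> and x = x and k = k] unfolding u_def E_def by simp
  qed
  have Zc: "continuous_on UNIV (Z k)" for k
    unfolding Z using wc by (intro continuous_intros) (use N in auto)
  have dc: "continuous_on UNIV (\<lambda>x. E x * (of_real N * Z k x))" for k
    using Ec Zc by (intro continuous_intros)
  have u: "u \<in> C01 \<Omega>" "partial k u = (\<lambda>x. E x * (of_real N * Z k x))" for k
    using C01I[of u \<Omega> "\<lambda>k x. E x * (of_real N * Z k x)", OF uC0 du dc] by auto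
  have E0: "E x \<noteq> 0" for x by (simp add: E_def)
  have Enorm: "cmod (E x) = exp (a x)" for x by (simp add: E_def \<kappa>)
  have f: "(\<lambda>x. partial k u x * cnj (partial h (pow_mult q u) x)) = (\<lambda>x. of_real (N * N) * G h k x)" for h k
  proof
    fix x
    have "cmod (E x) powr (q - 2) * (cmod (E x) * cmod (E x)) = exp (q * a x)"
      unfolding Enorm by (simp add: powr_def algebra_simps flip: exp_add)
    then have e: "E x * cnj (E x) * of_real (cmod (E x) powr (q - 2)) = of_real (exp (q * a x))"
      by (metis complex_norm_square mult.commute of_real_mult of_real_power power2_eq_square)
    have "partial h (pow_mult q u) x
        = of_real (cmod (E x) powr (q - 2) * pow_weight q (of_real (w x))) * E x * (of_real N * stretch q (Z h x))"
      unfolding partial_pow_mult[OF assms(1) u(1) assms(2)] u(2) stretch_scale[symmetric]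
      unfolding u_def by (rule pow_deriv_modulated[OF assms(2) E0])
    then have "partial k u x * cnj (partial h (pow_mult q u) x)
        = (E x * cnj (E x) * of_real (cmod (E x) powr (q - 2))) * of_real (N * N) * of_real (pow_weight q (of_real (w x))) * (Z k x * cnj (stretch q (Z h x)))"
      unfolding u(2) by (simp add: mult_ac)
    then show "partial k u x * cnj (partial h (pow_mult q u) x) = of_real (N * N) * G h k x"
      unfolding e G a_def by (simp add: mult_ac)
  qed
  have GC0: "G h k \<in> C0 \<Omega>" for h k
  proof -
    have "continuous_on UNIV (\<lambda>x. cnj (partial h (pow_mult q u) x))"
      unfolding partial_pow_mult[OF assms(1) u(1) assms(2)]
      by (intro continuous_on_cnj continuous_on_pow_deriv assms(2) C0_continuous[OF assms(1)]
          uC0 C01_partial(2)[OF assms(1) u(1)])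
    from C0_mult_continuous[OF assms(1) C01_partial(2)[OF assms(1) u(1)] this, of k]
    have "(\<lambda>x. of_real (N * N) * G h k x) \<in> C0 \<Omega>" unfolding f .
    from C0_scale[OF assms(1) this, of "1 / of_real (N * N)"] show ?thesis using N by simp
  qed
  then show "osc_density q w w' \<xi> \<kappa> N \<theta> h k \<in> C0 \<Omega>" for h k unfolding G_def .
  have "sesq_form A u (pow_mult q u) = (\<Sum>h\<in>UNIV. \<Sum>k\<in>UNIV. of_real (N * N) * (A $ h $ k) (G h k))"
    unfolding sesq_form_def f using dual_scale[OF assms(3) GC0] by simp
  also have "\<dots> = of_real (N * N) * (\<Sum>h\<in>UNIV. \<Sum>k\<in>UNIV. (A $ h $ k) (G h k))"
    by (simp only: sum_distrib_left)
  finally have "0 \<le> (N * N) * Re (\<Sum>h\<in>UNIV. \<Sum>k\<in>UNIV. (A $ h $ k) (G h k))"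
    using diss[OF u(1)] by simp
  then show "0 \<le> Re (\<Sum>h\<in>UNIV. \<Sum>k\<in>UNIV. (A $ h $ k) (osc_density q w w' \<xi> \<kappa> N \<theta> h k))"
    using mult_pos_pos[OF N N] unfolding G_def[symmetric]
      zero_le_mult_iff[of "N * N"] by linarith
qed

text \<open>For a general measure, for instance one with atoms, the factor \<open>cos^2\<close> need
  not average out as \<open>N\<close> grows. Adding two phases makes it disappear before the limit,
  so that uniform convergence on a fixed compact set suffices.\<close>

lemma oscillation_limit:
  fixes A :: "'n functional^'n^'n"
  assumes "open \<Omega>" "q \<ge> 2" "\<And>h k. A $ h $ k \<in> C0_dual \<Omega>"
    and diss: "\<And>u. u \<in> C01 \<Omega> \<Longrightarrow> 0 \<le> Re (sesq_form A u (pow_mult q u))"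
    and w: "C1 w w'" "(\<lambda>x. complex_of_real (w x)) \<in> C0 \<Omega>"
    and \<kappa>: "Re \<kappa> = 1"
  shows "0 \<le> Re (\<Sum>h\<in>UNIV. \<Sum>k\<in>UNIV. (A $ h $ k)
      (\<lambda>x. of_real (\<xi> $ k * \<xi> $ h) * (\<kappa> * cnj (stretch q \<kappa>)) * of_real (\<bar>w x\<bar> powr q)))"
proof -
  have wc: "continuous_on UNIV w" "continuous_on UNIV (w' k)" for k using w(1) by (auto simp: C1_def)
  have w'C0: "(\<lambda>x. complex_of_real (w' k x)) \<in> C0 \<Omega>" for k
  proof -
    have d: "((\<lambda>t. complex_of_real (w (x + t *\<^sub>R axis k 1))) has_vector_derivative of_real (w' k x)) (at 0)" for k x
      using w(1) by (auto simp: C1_def intro!: has_vector_derivative_of_real)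
    have c: "continuous_on UNIV (\<lambda>x. complex_of_real (w' k x))" for k
      using wc by (intro continuous_intros)
    show ?thesis
      using C01_partial(2)[OF assms(1) C01I(1)[OF w(2) d c], of k]
      unfolding C01I(2)[of "\<lambda>x. complex_of_real (w x)" \<Omega> "\<lambda>k x. of_real (w' k x)" k, OF w(2) d c] .
  qed
  obtain S0 where S0: "compact S0" "S0 \<subseteq> \<Omega>" "\<And>x. complex_of_real (w x) \<noteq> 0 \<Longrightarrow> x \<in> S0"
    by (rule C0_supportE[OF w(2)]) (rule that)
  have "\<exists>S. compact S \<and> S \<subseteq> \<Omega> \<and> (\<forall>x. w' k x \<noteq> 0 \<longrightarrow> x \<in> S)" for k
    by (rule C0_supportE[OF w'C0[of k]]) auto
  then obtain S where S: "\<And>k. compact (S k)" "\<And>k. S k \<subseteq> \<Omega>" "\<And>k x. w' k x \<noteq> 0 \<Longrightarrow> x \<in> S k"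
    by metis
  define K where "K = S0 \<union> (\<Union>k\<in>UNIV. S k)"
  have K: "compact K" unfolding K_def using S0(1) S(1) by (intro compact_Un compact_UN) auto
  have K\<Omega>: "K \<subseteq> \<Omega>" unfolding K_def using S0(2) S(2) by (intro Un_least UN_least)
  have off: "w x = 0" "w' k x = 0" if "x \<notin> K" for x k
    using that S0(3)[of x] S(3)[of k x] by (auto simp: K_def)
  obtain B0 where B0: "B0 > 0" "\<And>x. cmod (complex_of_real (w x)) \<le> B0"
    by (rule C0_bounded[OF assms(1) w(2)]) (rule that)
  have "\<exists>b>0. \<forall>x. \<bar>w' k x\<bar> \<le> b" for k
    by (rule C0_bounded[OF assms(1) w'C0[of k]]) auto
  then obtain b where b: "\<And>k. b k > 0" "\<And>k x. \<bar>w' k x\<bar> \<le> b k" by metis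
  define B where "B = B0 + (\<Sum>k\<in>UNIV. b k)"
  have B: "B \<ge> 0" "\<bar>w x\<bar> \<le> B" "\<bar>w' k x\<bar> \<le> B" for x k
  proof -
    have "b k \<le> (\<Sum>k\<in>UNIV. b k)" using b(1) by (intro member_le_sum) (auto intro: less_imp_le)
    moreover have "0 \<le> (\<Sum>k\<in>UNIV. b k)" using b(1) by (intro sum_nonneg) (auto intro: less_imp_le)
    ultimately show "B \<ge> 0" "\<bar>w x\<bar> \<le> B" "\<bar>w' k x\<bar> \<le> B"
      using B0(1) B0(2)[of x] b(2)[of k x] by (auto simp: B_def)
  qed
  \<comment> \<open>The 1 covers \<open>q = 2\<close>, where the weight is constantly 1.\<close>
  define M where "M = max 1 (B powr (q - 2))"
  have M: "\<bar>pow_weight q (of_real (w x))\<bar> \<le> M" for x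
    using B(2)[of x] assms(2) powr_mono2[of "q - 2" "\<bar>w x\<bar>" B] by (auto simp: pow_weight_def M_def)
  define C where "C = cmod \<kappa> * (B * norm \<xi>)"
  have C: "C \<ge> 0" using B(1) by (simp add: C_def)
  \<comment> \<open>The leading part of \<open>osc_grad\<close>; the omitted term
    \<open>w' k x / N\<close> is at most \<open>B / N\<close>.\<close>
  define Z0 where "Z0 N \<theta> k x = \<kappa> * complex_of_real (w x * cos (N\<^sup>2 * (\<xi> \<bullet> x) + \<theta>) * \<xi> $ k)" for N \<theta> k x
  have Z0: "cmod (Z0 N \<theta> k x) \<le> C" for N \<theta> k x
  proof -
    have "\<bar>w x\<bar> * \<bar>cos (N\<^sup>2 * (\<xi> \<bullet> x) + \<theta>)\<bar> \<le> B * 1"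
      using B by (intro mult_mono) (auto simp: abs_cos_le_one)
    then have "\<bar>w x\<bar> * \<bar>cos (N\<^sup>2 * (\<xi> \<bullet> x) + \<theta>)\<bar> * \<bar>\<xi> $ k\<bar> \<le> B * norm \<xi>"
      using B(1) by (intro mult_mono component_le_norm_cart) auto
    then show ?thesis unfolding Z0_def C_def norm_mult norm_of_real abs_mult
      by (rule mult_left_mono) simp
  qed
  \<comment> \<open>The bound of \<open>modulation_error\<close> for \<open>d = B / N\<close> and
    \<open>\<rho> = q / N\<close>.\<close>
  define err where "err N = (exp (q / N) - 1) * ((C + B / N) * (q * (C + B / N))) + B / N * (q * (C + B / N)) + C * (q * (B / N))"
    for N :: real
  have err: "cmod (osc_density q w w' \<xi> \<kappa> N \<theta> h k x
      - of_real (pow_weight q (of_real (w x))) * (Z0 N \<theta> k x * cnj (stretch q (Z0 N \<theta> h x)))) \<le> M * err N"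
    if N: "N > 0" for N \<theta> h k x
  proof -
    have d: "cmod (osc_grad w w' \<xi> \<kappa> N \<theta> k x - Z0 N \<theta> k x) \<le> B / N" for k
      using B(3)[of k x] N unfolding osc_grad_def Z0_def by (simp add: norm_divide divide_right_mono)
    have "\<bar>q * (sin (N\<^sup>2 * (\<xi> \<bullet> x) + \<theta>) / N)\<bar> = q / N * \<bar>sin (N\<^sup>2 * (\<xi> \<bullet> x) + \<theta>)\<bar>"
      using N assms(2) by (simp add: abs_mult)
    also have "\<dots> \<le> q / N * 1"
      using N assms(2) by (intro mult_left_mono abs_sin_le_one) auto
    finally have s: "\<bar>q * (sin (N\<^sup>2 * (\<xi> \<bullet> x) + \<theta>) / N)\<bar> \<le> q / N" by simp
    have BN: "0 \<le> B / N" using B(1) N by simp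
    have m: "cmod (of_real (exp (q * (sin (N\<^sup>2 * (\<xi> \<bullet> x) + \<theta>) / N))) *
        (osc_grad w w' \<xi> \<kappa> N \<theta> k x * cnj (stretch q (osc_grad w w' \<xi> \<kappa> N \<theta> h x)))
        - Z0 N \<theta> k x * cnj (stretch q (Z0 N \<theta> h x))) \<le> err N"
      unfolding err_def by (rule modulation_error[OF assms(2) BN C Z0 Z0 d d s])
    show ?thesis unfolding osc_density_def right_diff_distrib[symmetric] norm_mult[of "of_real _"] norm_of_real
      by (rule mult_mono[OF M m]) (simp_all add: M_def)
  qed
  define g where "g h k x = of_real (\<xi> $ k * \<xi> $ h) * (\<kappa> * cnj (stretch q \<kappa>)) * complex_of_real (\<bar>w x\<bar> powr q)" for h k x
  have gC0: "g h k \<in> C0 \<Omega>" for h k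
  proof -
    have "continuous_on UNIV (\<lambda>x. \<bar>w x\<bar> powr q)"
      using wc assms(2) by (intro continuous_on_powr' continuous_intros) auto
    then show ?thesis unfolding g_def
      by (intro C0I[OF _ K K\<Omega>]) (use off in \<open>auto intro!: continuous_intros\<close>)
  qed
  have g: "of_real (pow_weight q (of_real (w x))) * (Z0 N 0 k x * cnj (stretch q (Z0 N 0 h x)))
     + of_real (pow_weight q (of_real (w x))) * (Z0 N (pi / 2) k x * cnj (stretch q (Z0 N (pi / 2) h x))) = g h k x" for N h k x
  proof -
    define y where "y = N\<^sup>2 * (\<xi> \<bullet> x)"
    have Z: "Z0 N \<theta> k x * cnj (stretch q (Z0 N \<theta> h x))
       = of_real (w x * w x * (cos (y + \<theta>) * cos (y + \<theta>)) * (\<xi> $ k * \<xi> $ h)) * (\<kappa> * cnj (stretch q \<kappa>))" for \<theta>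
      unfolding Z0_def y_def[symmetric] mult.commute[of \<kappa>] stretch_scale by (simp add: mult_ac)
    have "cos (y + pi / 2) = - sin y" by (simp add: cos_add)
    then have cs: "cos (y + 0) * cos (y + 0) + cos (y + pi / 2) * cos (y + pi / 2) = 1"
      using sin_cos_squared_add3[of y] by simp
    have "of_real (pow_weight q (of_real (w x))) * (Z0 N 0 k x * cnj (stretch q (Z0 N 0 h x)))
     + of_real (pow_weight q (of_real (w x))) * (Z0 N (pi / 2) k x * cnj (stretch q (Z0 N (pi / 2) h x)))
      = of_real (pow_weight q (of_real (w x)) * (w x * w x)
           * (cos (y + 0) * cos (y + 0) + cos (y + pi / 2) * cos (y + pi / 2)) * (\<xi> $ k * \<xi> $ h)) * (\<kappa> * cnj (stretch q \<kappa>))"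
      unfolding Z by (simp only: of_real_mult of_real_add distrib_left distrib_right mult_ac)
    then show ?thesis unfolding cs pow_weight_square[OF assms(2)] g_def by (simp add: mult_ac)
  qed
  \<comment> \<open>Only the sum of the two phases has a limit independent of the oscillation.
    Taking \<open>N = Suc n\<close> keeps \<open>N\<close> positive.\<close>
  define F where "F n h k x = osc_density q w w' \<xi> \<kappa> (real (Suc n)) 0 h k x
      + osc_density q w w' \<xi> \<kappa> (real (Suc n)) (pi / 2) h k x" for n h k x
  have osc: "osc_density q w w' \<xi> \<kappa> (real (Suc n)) \<theta> h k \<in> C0 \<Omega>"
    "0 \<le> Re (\<Sum>h\<in>UNIV. \<Sum>k\<in>UNIV. (A $ h $ k) (osc_density q w w' \<xi> \<kappa> (real (Suc n)) \<theta> h k))" for n \<theta> h k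
    using sesq_form_oscillation[OF assms(1-3) diss w _ \<kappa>] by auto
  have FC0: "F n h k \<in> C0 \<Omega>" for n h k
    unfolding F_def by (intro C0_add[OF assms(1)] osc)
  have errlim: "(\<lambda>n. 2 * (M * err (real (Suc n)))) \<longlonglongrightarrow> 0"
  proof -
    have l: "(\<lambda>n. c / real (Suc n)) \<longlonglongrightarrow> 0" for c
      using tendsto_mult_left[OF lim_1_over_n[THEN LIMSEQ_Suc], of c] by simp
    have "(\<lambda>n. 2 * (M * err (real (Suc n)))) \<longlonglongrightarrow>
        2 * (M * ((exp 0 - 1) * ((C + 0) * (q * (C + 0))) + 0 * (q * (C + 0)) + C * (q * 0)))"
      unfolding err_def by (intro tendsto_intros l)
    then show ?thesis by simp
  qed
  have lim: "(\<lambda>n. (A $ h $ k) (F n h k)) \<longlonglongrightarrow> (A $ h $ k) (g h k)" for h k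
  proof (rule dual_tendsto[OF assms(1,3) K K\<Omega>])
    show "cmod (F n h k x - g h k x) \<le> 2 * (M * err (real (Suc n)))" for n x
    proof -
      have "F n h k x - g h k x
        = (osc_density q w w' \<xi> \<kappa> (real (Suc n)) 0 h k x
           - of_real (pow_weight q (of_real (w x))) * (Z0 (real (Suc n)) 0 k x * cnj (stretch q (Z0 (real (Suc n)) 0 h x))))
        + (osc_density q w w' \<xi> \<kappa> (real (Suc n)) (pi / 2) h k x
           - of_real (pow_weight q (of_real (w x))) * (Z0 (real (Suc n)) (pi / 2) k x * cnj (stretch q (Z0 (real (Suc n)) (pi / 2) h x))))"
        unfolding F_def g[of x "real (Suc n)" k h, symmetric] by (simp only: add_diff_add)
      also have "cmod \<dots> \<le> M * err (real (Suc n)) + M * err (real (Suc n))"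
        by (intro norm_triangle_mono err) simp_all
      finally show ?thesis by simp
    qed
    show "x \<in> K" if "F n h k x \<noteq> 0" for n x
    proof (rule ccontr)
      assume "x \<notin> K"
      then have "F n h k x = 0" using off by (simp add: F_def osc_density_def osc_grad_def)
      with that show False ..
    qed
    show "x \<in> K" if "g h k x \<noteq> 0" for x
      using that off(1)[of x] by (auto simp: g_def)
  qed (use FC0 gC0 errlim in auto)
  have "(\<lambda>n. Re (\<Sum>h\<in>UNIV. \<Sum>k\<in>UNIV. (A $ h $ k) (F n h k))) \<longlonglongrightarrow> Re (\<Sum>h\<in>UNIV. \<Sum>k\<in>UNIV. (A $ h $ k) (g h k))"
    by (intro tendsto_intros lim)
  moreover have "0 \<le> Re (\<Sum>h\<in>UNIV. \<Sum>k\<in>UNIV. (A $ h $ k) (F n h k))" for n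
  proof -
    have "(A $ h $ k) (F n h k) = (A $ h $ k) (osc_density q w w' \<xi> \<kappa> (real (Suc n)) 0 h k)
        + (A $ h $ k) (osc_density q w w' \<xi> \<kappa> (real (Suc n)) (pi / 2) h k)" for h k
      unfolding F_def by (rule dual_add[OF assms(3) osc(1) osc(1)])
    then show ?thesis using osc(2)[of n 0] osc(2)[of n "pi / 2"]
      by (simp add: sum.distrib del: of_nat_Suc)
  qed
  ultimately show ?thesis unfolding g_def by (intro LIMSEQ_le_const) auto
qed

section \<open>Total variation and the main equivalence\<close>

text \<open>\<open>oscillation_limit\<close> gives positivity of one scalar functional \<mu> on the
  functions \<open>|w|^q\<close>, and \<open>dual_nonneg_from_powers\<close> extends it to all
  nonnegative \<phi>. The two signs \<sigma> combine into the modulus of \<open>I\<close>.\<close>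

lemma algebraic_condition_of_dissipative:
  fixes A :: "'n functional^'n^'n"
  assumes "open \<Omega>" "q \<ge> 2" "\<And>h k. A $ h $ k \<in> C0_dual \<Omega>"
    and diss: "\<And>u. u \<in> C01 \<Omega> \<Longrightarrow> 0 \<le> Re (sesq_form A u (pow_mult q u))"
  shows "algebraic_condition \<Omega> q A"
  unfolding algebraic_condition_def
proof (intro allI impI)
  fix \<xi> :: "real^'n" and \<phi> :: "real^'n \<Rightarrow> real"
  assume \<phi>: "(\<lambda>x. complex_of_real (\<phi> x)) \<in> C0 \<Omega> \<and> (\<forall>x. 0 \<le> \<phi> x)"
  define a where "a h k = (A $ h $ k) (\<lambda>x. complex_of_real (\<phi> x))" for h k
  define s where "s = sqrt (q - 1)"
  define R where "R = (\<Sum>h\<in>UNIV. \<Sum>k\<in>UNIV. \<xi> $ k * \<xi> $ h * Re (a h k))"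
  define I where "I = (\<Sum>h\<in>UNIV. \<Sum>k\<in>UNIV. \<xi> $ k * \<xi> $ h * Im (a h k))"
  have s: "s > 0" "s * s = q - 1" using assms(2) by (auto simp: s_def)
  have *: "\<sigma> * (q - 2) * I \<le> 2 * s * R" if \<sigma>: "\<sigma> * \<sigma> = 1" for \<sigma> :: real
  proof -
    define \<kappa> where "\<kappa> = Complex 1 (\<sigma> * s)"
    have c: "\<kappa> * cnj (stretch q \<kappa>) = Complex (2 * (q - 1)) (\<sigma> * s * (q - 2))"
      unfolding \<kappa>_def s_def using assms(2) by (intro stretch_direction \<sigma>) auto
    define \<mu> where "\<mu> f = (\<Sum>h\<in>UNIV. 1 * (\<Sum>k\<in>UNIV. (of_real (\<xi> $ k * \<xi> $ h) * (\<kappa> * cnj (stretch q \<kappa>))) * (A $ h $ k) f))" for f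
    have \<mu>: "\<mu> \<in> C0_dual \<Omega>"
      unfolding \<mu>_def by (intro dual_weighted_sum[OF assms(1)] assms(3))
    have "0 \<le> Re (\<mu> (\<lambda>x. complex_of_real (\<phi> x)))"
    proof (rule dual_nonneg_from_powers[OF assms(1) \<mu>])
      fix w w' assume w: "C1 w w'" "(\<lambda>x. complex_of_real (w x)) \<in> C0 \<Omega>"
      have wq: "(\<lambda>x. complex_of_real (\<bar>w x\<bar> powr q)) \<in> C0 \<Omega>"
      proof -
        obtain K where K: "compact K" "K \<subseteq> \<Omega>" "\<And>x. complex_of_real (w x) \<noteq> 0 \<Longrightarrow> x \<in> K"
          by (rule C0_supportE[OF w(2)]) (rule that)
        have "continuous_on UNIV (\<lambda>x. \<bar>w x\<bar> powr q)"
          using w(1) assms(2) by (intro continuous_on_powr' continuous_intros) (auto simp: C1_def)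
        then show ?thesis
          by (intro C0I[OF _ K(1,2)]) (use K(3) in \<open>auto intro!: continuous_intros\<close>)
      qed
      have "0 \<le> Re (\<Sum>h\<in>UNIV. \<Sum>k\<in>UNIV. (A $ h $ k)
          (\<lambda>x. of_real (\<xi> $ k * \<xi> $ h) * (\<kappa> * cnj (stretch q \<kappa>)) * of_real (\<bar>w x\<bar> powr q)))"
        by (rule oscillation_limit[OF assms(1-3) diss w]) (simp_all add: \<kappa>_def)
      then show "0 \<le> Re (\<mu> (\<lambda>x. complex_of_real (\<bar>w x\<bar> powr q)))"
        unfolding \<mu>_def dual_scale[OF assms(3) wq] by simp
    qed (use \<phi> assms(2) in auto)
    \<comment> \<open>One factor \<open>s\<close> splits off from \<kappa> times the conjugate of
      its stretch; it is positive and is cancelled afterwards.\<close>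
    also have "Re (\<mu> (\<lambda>x. complex_of_real (\<phi> x))) = s * (2 * s * R - \<sigma> * (q - 2) * I)"
      unfolding \<mu>_def c a_def[symmetric] R_def I_def s(2)[symmetric] sum_distrib_left sum_subtractf[symmetric] Re_sum
      by (intro sum.cong refl) (simp add: s_def[symmetric] algebra_simps)
    finally show ?thesis using s(1) by (simp add: zero_le_mult_iff)
  qed
  have "(q - 2) * \<bar>I\<bar> \<le> 2 * s * R" using *[of 1] *[of "-1"] by (auto simp: abs_if algebra_simps)
  then show "(q - 2) * \<bar>\<Sum>h\<in>UNIV. \<Sum>k\<in>UNIV. \<xi> $ k * \<xi> $ h * Im ((A $ h $ k) (\<lambda>x. complex_of_real (\<phi> x)))\<bar>
     \<le> 2 * sqrt (q - 1) * (\<Sum>h\<in>UNIV. \<Sum>k\<in>UNIV. \<xi> $ k * \<xi> $ h * Re ((A $ h $ k) (\<lambda>x. complex_of_real (\<phi> x))))"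
    unfolding I_def R_def s_def a_def .
qed

section \<open>Real and imaginary parts of measures on real functions\<close>

lemma meas_Re_of_real: "meas_Re \<mu> (\<lambda>x. complex_of_real (g x)) = of_real (Re (\<mu> (\<lambda>x. complex_of_real (g x))))"
  by (simp add: meas_Re_def meas_cnj_def complex_add_cnj)

lemma meas_Im_of_real: "meas_Im \<mu> (\<lambda>x. complex_of_real (g x)) = of_real (Im (\<mu> (\<lambda>x. complex_of_real (g x))))"
  by (simp add: meas_Im_def meas_cnj_def complex_diff_cnj complex_eq_iff)

lemma quad_Re_of_real:
  "quad (mat_Re A) \<xi> (\<lambda>x. complex_of_real (g x)) =
     of_real (\<Sum>h\<in>UNIV. \<Sum>k\<in>UNIV. \<xi> $ k * \<xi> $ h * Re ((A $ h $ k) (\<lambda>x. complex_of_real (g x))))"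
  by (simp add: quad_def mat_Re_def meas_Re_of_real)

lemma quad_Im_of_real:
  "quad (mat_Im A) \<xi> (\<lambda>x. complex_of_real (g x)) =
     of_real (\<Sum>h\<in>UNIV. \<Sum>k\<in>UNIV. \<xi> $ k * \<xi> $ h * Im ((A $ h $ k) (\<lambda>x. complex_of_real (g x))))"
  by (simp add: quad_def mat_Im_def meas_Im_of_real)

lemma quad_dual:
  assumes "open \<Omega>" "\<And>h k. M $ h $ k \<in> C0_dual \<Omega>"
  shows "quad M \<xi> \<in> C0_dual \<Omega>"
proof -
  have "(\<lambda>f. \<Sum>h\<in>UNIV. 1 * (\<Sum>k\<in>UNIV. complex_of_real (\<xi> $ k * \<xi> $ h) * (M $ h $ k) f)) \<in> C0_dual \<Omega>"
    by (intro dual_weighted_sum assms)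
  then show ?thesis unfolding quad_def[abs_def] by simp
qed

lemma dual_meas_Re_Im:
  assumes "open \<Omega>" "\<mu> \<in> C0_dual \<Omega>"
  shows "meas_Re \<mu> \<in> C0_dual \<Omega>" "meas_Im \<mu> \<in> C0_dual \<Omega>"
proof -
  have "(\<lambda>f. (1 / 2) * \<mu> f + (1 / 2) * meas_cnj \<mu> f) \<in> C0_dual \<Omega>"
    "(\<lambda>f. (1 / (2 * \<i>)) * \<mu> f + (- 1 / (2 * \<i>)) * meas_cnj \<mu> f) \<in> C0_dual \<Omega>"
    by (intro dual_lincomb dual_meas_cnj assms)+
  moreover have "meas_Re \<mu> = (\<lambda>f. (1 / 2) * \<mu> f + (1 / 2) * meas_cnj \<mu> f)"
    "meas_Im \<mu> = (\<lambda>f. (1 / (2 * \<i>)) * \<mu> f + (- 1 / (2 * \<i>)) * meas_cnj \<mu> f)"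
    by (rule ext, simp add: meas_Re_def meas_Im_def field_simps)+
  ultimately show "meas_Re \<mu> \<in> C0_dual \<Omega>" "meas_Im \<mu> \<in> C0_dual \<Omega>" by simp_all
qed

text \<open>From left to right, \<phi> itself competes in the supremum. Conversely, a competitor
  \<open>g\<close> is rotated so that its value is that of a real \<open>r\<close> with
  \<open>\<bar>r\<bar> \<le> \<phi>\<close>. The inequality for the nonnegative functions
  \<open>\<phi> + r\<close> and \<open>\<phi> - r\<close> is added, and the triangle inequality
  isolates the value at \<open>r\<close>, with no Jordan decomposition.\<close>

lemma total_variation_le_iff:
  assumes "open \<Omega>" "\<mu> \<in> C0_dual \<Omega>" "\<nu> \<in> C0_dual \<Omega>" "c \<ge> 0"
    and \<mu>_real: "\<And>g. \<mu> (\<lambda>x. complex_of_real (g x)) \<in> \<real>"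
  shows "(\<forall>\<phi>. (\<lambda>x. complex_of_real (\<phi> x)) \<in> C0 \<Omega> \<and> (\<forall>x. 0 \<le> \<phi> x) \<longrightarrow>
            c * total_variation \<Omega> \<mu> \<phi> \<le> Re (\<nu> (\<lambda>x. complex_of_real (\<phi> x))))
     \<longleftrightarrow> (\<forall>\<phi>. (\<lambda>x. complex_of_real (\<phi> x)) \<in> C0 \<Omega> \<and> (\<forall>x. 0 \<le> \<phi> x) \<longrightarrow>
            c * cmod (\<mu> (\<lambda>x. complex_of_real (\<phi> x))) \<le> Re (\<nu> (\<lambda>x. complex_of_real (\<phi> x))))"
    (is "?L \<longleftrightarrow> ?R")
proof
  assume L: ?L
  show ?R
  proof (intro allI impI)
    fix \<phi> :: "real^'a \<Rightarrow> real" assume \<phi>: "(\<lambda>x. complex_of_real (\<phi> x)) \<in> C0 \<Omega> \<and> (\<forall>x. 0 \<le> \<phi> x)"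
    obtain K where K: "compact K" "K \<subseteq> \<Omega>" "\<And>x. complex_of_real (\<phi> x) \<noteq> 0 \<Longrightarrow> x \<in> K"
      by (rule C0_supportE[OF conjunct1[OF \<phi>]]) (rule that)
    obtain B where B: "B > 0" "\<And>x. cmod (complex_of_real (\<phi> x)) \<le> B"
      by (rule C0_bounded[OF assms(1) conjunct1[OF \<phi>]]) (rule that)
    obtain D where D: "D \<ge> 0" "\<And>f b. f \<in> C0 \<Omega> \<Longrightarrow> (\<And>x. f x \<noteq> 0 \<Longrightarrow> x \<in> K) \<Longrightarrow>
        (\<And>x. cmod (f x) \<le> b) \<Longrightarrow> cmod (\<mu> f) \<le> D * b"
      by (rule dual_bound[OF assms(2) K(1,2)]) (rule that, assumption, blast)
    \<comment> \<open>The real supremum dominates its members only once boundedness is known. Every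
      competitor vanishes where \<phi> does, so one constant of \<open>dual_bound\<close> works for
      all of them.\<close>
    have "cmod (\<mu> g) \<le> D * B" if g: "g \<in> C0 \<Omega>" "\<forall>x. cmod (g x) \<le> \<phi> x" for g
    proof (rule D(2)[OF g(1)])
      fix x
      show "x \<in> K" if "g x \<noteq> 0"
      proof -
        have "\<phi> x \<noteq> 0" using g(2)[rule_format, of x] that by auto
        then show ?thesis by (intro K(3)) simp
      qed
      show "cmod (g x) \<le> B" using g(2)[rule_format, of x] B(2)[of x] by auto
    qed
    then have "bdd_above ((\<lambda>g. cmod (\<mu> g)) ` {g \<in> C0 \<Omega>. \<forall>x. cmod (g x) \<le> \<phi> x})"
      by (intro bdd_aboveI2[of _ _ "D * B"]) auto
    then have "cmod (\<mu> (\<lambda>x. complex_of_real (\<phi> x))) \<le> total_variation \<Omega> \<mu> \<phi>"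
      unfolding total_variation_def using \<phi> by (intro cSUP_upper) auto
    then have "c * cmod (\<mu> (\<lambda>x. complex_of_real (\<phi> x))) \<le> c * total_variation \<Omega> \<mu> \<phi>"
      using assms(4) by (rule mult_left_mono)
    also have "\<dots> \<le> Re (\<nu> (\<lambda>x. complex_of_real (\<phi> x)))" using L \<phi> by blast
    finally show "c * cmod (\<mu> (\<lambda>x. complex_of_real (\<phi> x))) \<le> Re (\<nu> (\<lambda>x. complex_of_real (\<phi> x)))" .
  qed
next
  assume R: ?R
  show ?L
  proof (intro allI impI)
    fix \<phi> :: "real^'a \<Rightarrow> real" assume \<phi>: "(\<lambda>x. complex_of_real (\<phi> x)) \<in> C0 \<Omega> \<and> (\<forall>x. 0 \<le> \<phi> x)"
    let ?\<phi> = "\<lambda>x. complex_of_real (\<phi> x)"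
    have bound: "c * cmod (\<mu> g) \<le> Re (\<nu> ?\<phi>)" if g: "g \<in> C0 \<Omega>" "\<forall>x. cmod (g x) \<le> \<phi> x" for g
    proof -
      obtain e where e: "cmod e = 1" "e * \<mu> g = of_real (cmod (\<mu> g))"
      proof (cases "\<mu> g = 0")
        case False
        show thesis
        proof (rule that[of "cnj (\<mu> g) / of_real (cmod (\<mu> g))"])
          show "cnj (\<mu> g) / of_real (cmod (\<mu> g)) * \<mu> g = of_real (cmod (\<mu> g))"
            using False complex_norm_square[of "\<mu> g"] by (simp add: field_simps power2_eq_square)
        qed (use False in \<open>simp add: norm_divide\<close>)
      qed (use that[of 1] in simp)
      define r where "r x = Re (e * g x)" for x
      define m where "m x = Im (e * g x)" for x
      have egC0: "(\<lambda>x. e * g x) \<in> C0 \<Omega>" by (rule C0_scale[OF assms(1) g(1)])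
      have rC0: "(\<lambda>x. complex_of_real (r x)) \<in> C0 \<Omega>"
        unfolding r_def by (rule C0_Re[OF assms(1) egC0])
      have mC0: "(\<lambda>x. complex_of_real (m x)) \<in> C0 \<Omega>"
      proof -
        have "m x = Re (- \<i> * (e * g x))" for x by (simp add: m_def)
        then show ?thesis using C0_Re[OF assms(1) C0_scale[OF assms(1) egC0, of "-\<i>"]] by presburger
      qed
      have "(\<lambda>x. e * g x) = (\<lambda>x. of_real (r x) + \<i> * of_real (m x))"
        unfolding r_def m_def by (rule ext, rule complex_eq)
      then have "\<mu> (\<lambda>x. e * g x) = \<mu> (\<lambda>x. of_real (r x) + \<i> * of_real (m x))" by simp
      also have "\<dots> = \<mu> (\<lambda>x. of_real (r x)) + \<i> * \<mu> (\<lambda>x. of_real (m x))"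
        unfolding dual_add[OF assms(2) rC0 C0_scale[OF assms(1) mC0]] dual_scale[OF assms(2) mC0] ..
      finally have "of_real (cmod (\<mu> g)) = \<mu> (\<lambda>x. of_real (r x)) + \<i> * \<mu> (\<lambda>x. of_real (m x))"
        unfolding dual_scale[OF assms(2) g(1)] e(2) .
      moreover obtain mr where "\<mu> (\<lambda>x. of_real (m x)) = complex_of_real mr" using \<mu>_real[of m] by (auto elim: Reals_cases)
      moreover obtain rr where rr: "\<mu> (\<lambda>x. of_real (r x)) = complex_of_real rr" using \<mu>_real[of r] by (auto elim: Reals_cases)
      \<comment> \<open>Since \<mu> is real on real functions, comparing real parts discards the
        contribution of \<open>m\<close>.\<close>
      ultimately have gr: "cmod (\<mu> g) = rr" by (simp add: complex_eq_iff)
      have rb: "\<bar>r x\<bar> \<le> \<phi> x" for x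
        using abs_Re_le_cmod[of "e * g x"] g(2) by (simp add: r_def norm_mult e(1)) (meson order_trans)
      have p: "(\<lambda>x. ?\<phi> x + of_real (r x)) \<in> C0 \<Omega>" and n: "(\<lambda>x. ?\<phi> x - of_real (r x)) \<in> C0 \<Omega>"
        using \<phi> rC0 by (auto intro: C0_add C0_diff assms(1))
      have "c * cmod (\<mu> (\<lambda>x. complex_of_real (\<phi> x + r x))) \<le> Re (\<nu> (\<lambda>x. complex_of_real (\<phi> x + r x)))"
        using R[rule_format, of "\<lambda>x. \<phi> x + r x"] p rb by (auto simp: abs_le_iff) (smt (verit))
      then have 1: "c * cmod (\<mu> ?\<phi> + of_real rr) \<le> Re (\<nu> ?\<phi> + \<nu> (\<lambda>x. of_real (r x)))"
        unfolding of_real_add dual_add[OF assms(2) conjunct1[OF \<phi>] rC0] dual_add[OF assms(3) conjunct1[OF \<phi>] rC0] rr .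
      have "c * cmod (\<mu> (\<lambda>x. complex_of_real (\<phi> x - r x))) \<le> Re (\<nu> (\<lambda>x. complex_of_real (\<phi> x - r x)))"
        using R[rule_format, of "\<lambda>x. \<phi> x - r x"] n rb by (auto simp: abs_le_iff)
      then have 2: "c * cmod (\<mu> ?\<phi> - of_real rr) \<le> Re (\<nu> ?\<phi> - \<nu> (\<lambda>x. of_real (r x)))"
        unfolding of_real_diff dual_diff[OF assms(1,2) conjunct1[OF \<phi>] rC0] dual_diff[OF assms(1,3) conjunct1[OF \<phi>] rC0] rr .
      have "cmod ((\<mu> ?\<phi> + of_real rr) - (\<mu> ?\<phi> - of_real rr)) \<le> cmod (\<mu> ?\<phi> + of_real rr) + cmod (\<mu> ?\<phi> - of_real rr)"
        by (rule norm_triangle_ineq4)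
      moreover have "cmod ((\<mu> ?\<phi> + of_real rr) - (\<mu> ?\<phi> - of_real rr)) = 2 * \<bar>rr\<bar>"
        by (simp flip: mult_2 of_real_add)
      ultimately have "c * (2 * \<bar>rr\<bar>) \<le> c * (cmod (\<mu> ?\<phi> + of_real rr) + cmod (\<mu> ?\<phi> - of_real rr))"
        using assms(4) by (intro mult_left_mono) auto
      also have "\<dots> \<le> 2 * Re (\<nu> ?\<phi>)" using 1 2 by (simp add: distrib_left)
      finally show ?thesis by (simp flip: gr)
    qed
    \<comment> \<open>For \<open>c = 0\<close>, which occurs when \<open>p = 2\<close>, division is
      impossible, but both sides then only say that \<nu> has nonnegative real part on
      \<phi>.\<close>
    show "c * total_variation \<Omega> \<mu> \<phi> \<le> Re (\<nu> ?\<phi>)"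
    proof (cases "c = 0")
      case True
      then show ?thesis using R \<phi> by auto
    next
      case False
      then have c: "c > 0" using assms(4) by simp
      have "total_variation \<Omega> \<mu> \<phi> \<le> Re (\<nu> ?\<phi>) / c"
        unfolding total_variation_def
      proof (rule cSUP_least)
        show "{g \<in> C0 \<Omega>. \<forall>x. cmod (g x) \<le> \<phi> x} \<noteq> {}" using \<phi> C0_zero by auto
        show "cmod (\<mu> g) \<le> Re (\<nu> ?\<phi>) / c" if "g \<in> {g \<in> C0 \<Omega>. \<forall>x. cmod (g x) \<le> \<phi> x}" for g
          using bound[of g] that c by (simp add: pos_le_divide_eq mult.commute)
      qed
      then show ?thesis using c by (simp add: pos_le_divide_eq mult.commute)
    qed
  qed
qed

text \<open>Carries the power from the first argument to the second, so that \<open>p < 2\<close>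
  becomes the case of the conjugate exponent \<open>p / (p - 1)\<close> for the adjoint
  matrix.\<close>

lemma sesq_form_adjoint:
  "sesq_form (\<chi> h k. meas_cnj (A $ k $ h)) u v = cnj (sesq_form A v u)"
  unfolding sesq_form_def by (subst sum.swap) (simp add: meas_cnj_def mult.commute)

text \<open>With \<open>q = p / (p - 1)\<close> one has \<open>q - 2 = (2 - p) / (p - 1)\<close> and
  \<open>sqrt (q - 1) = sqrt (p - 1) / (p - 1)\<close>, so the two inequalities differ by the
  positive factor \<open>1 / (p - 1)\<close>.\<close>

lemma exponent_rescaling:
  assumes "1 < p" "p < 2"
  shows "(p / (p - 1) - 2) * i \<le> 2 * sqrt (p / (p - 1) - 1) * r \<longleftrightarrow> (2 - p) * i \<le> 2 * sqrt (p - 1) * r"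
proof -
  have s: "sqrt (p - 1) > 0" "sqrt (p - 1) * sqrt (p - 1) = p - 1" using assms by auto
  have "p / (p - 1) - 1 = 1 / (p - 1)" using assms by (simp add: field_simps)
  then have r: "sqrt (p / (p - 1) - 1) = sqrt (p - 1) / (p - 1)"
    using s by (simp add: real_sqrt_divide field_simps)
  have "p / (p - 1) - 2 = (2 - p) / (p - 1)" using assms by (simp add: field_simps)
  then show ?thesis
    unfolding r using assms by (simp only: times_divide_eq_left times_divide_eq_right divide_le_cancel) auto
qed

theorem theorem1:
  fixes \<Omega> :: "(real^'n) set" and p :: real and A :: "'n functional^'n^'n"
  assumes "open \<Omega>"
    and "1 < p"
    and "\<And>h k. A $ h $ k \<in> C0_dual \<Omega>"
    and "\<And>h k. meas_eq \<Omega> (transpose (mat_Im A) $ h $ k) (mat_Im A $ h $ k)"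
  shows "Lp_dissipative \<Omega> p (sesq_form A) \<longleftrightarrow>
    (\<forall>\<xi> :: real^'n. \<forall>\<phi> :: real^'n \<Rightarrow> real.
       (\<lambda>x. complex_of_real (\<phi> x)) \<in> C0 \<Omega> \<and> (\<forall>x. 0 \<le> \<phi> x) \<longrightarrow>
       \<bar>p - 2\<bar> * total_variation \<Omega> (quad (mat_Im A) \<xi>) \<phi>
         \<le> 2 * sqrt (p - 1) * Re (quad (mat_Re A) \<xi> (\<lambda>x. complex_of_real (\<phi> x))))"
    (is "_ \<longleftrightarrow> ?C")
proof -
  \<comment> \<open>On a real test function the imaginary part of a measure takes the imaginary part
    of its value, so symmetry of the measures becomes symmetry of numbers.\<close>
  have sym: "Im ((A $ h $ k) (\<lambda>x. complex_of_real (\<phi> x))) = Im ((A $ k $ h) (\<lambda>x. complex_of_real (\<phi> x)))"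
    if "(\<lambda>x. complex_of_real (\<phi> x)) \<in> C0 \<Omega>" for h k \<phi>
    using assms(4)[of h k] that
    by (auto simp: meas_eq_def transpose_def mat_Im_def meas_Im_of_real dest!: bspec[of _ _ "\<lambda>x. complex_of_real (\<phi> x)"])
  define Rf If where "Rf \<xi> \<phi> = (\<Sum>h\<in>UNIV. \<Sum>k\<in>UNIV. \<xi> $ k * \<xi> $ h * Re ((A $ h $ k) (\<lambda>x. complex_of_real (\<phi> x))))"
    and "If \<xi> \<phi> = (\<Sum>h\<in>UNIV. \<Sum>k\<in>UNIV. \<xi> $ k * \<xi> $ h * Im ((A $ h $ k) (\<lambda>x. complex_of_real (\<phi> x))))"
    for \<xi> :: "real^'n" and \<phi> :: "real^'n \<Rightarrow> real"
  have "?C \<longleftrightarrow> (\<forall>\<xi> \<phi>. (\<lambda>x. complex_of_real (\<phi> x)) \<in> C0 \<Omega> \<and> (\<forall>x. 0 \<le> \<phi> x) \<longrightarrow>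
      \<bar>p - 2\<bar> * \<bar>If \<xi> \<phi>\<bar> \<le> 2 * sqrt (p - 1) * Rf \<xi> \<phi>)" (is "_ \<longleftrightarrow> ?D")
  proof (rule all_cong1)
    fix \<xi> :: "real^'n"
    \<comment> \<open>The constant of the criterion is absorbed into the right-hand measure; the
      vanishing second summand provides the shape of \<open>dual_lincomb\<close>.\<close>
    define \<nu> where "\<nu> f = of_real (2 * sqrt (p - 1)) * quad (mat_Re A) \<xi> f + 0 * quad (mat_Re A) \<xi> f" for f
    have q: "quad (mat_Im A) \<xi> \<in> C0_dual \<Omega>" "quad (mat_Re A) \<xi> \<in> C0_dual \<Omega>"
      using assms(1,3) by (auto intro!: quad_dual dual_meas_Re_Im simp: mat_Im_def mat_Re_def)
    have \<nu>: "\<nu> \<in> C0_dual \<Omega>" unfolding \<nu>_def by (intro dual_lincomb q assms(1))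
    have "quad (mat_Im A) \<xi> (\<lambda>x. complex_of_real (g x)) \<in> \<real>" for g
      by (simp add: quad_Im_of_real)
    from total_variation_le_iff[OF assms(1) q(1) \<nu> abs_ge_zero[of "p - 2"] this]
    show "(\<forall>\<phi>. (\<lambda>x. complex_of_real (\<phi> x)) \<in> C0 \<Omega> \<and> (\<forall>x. 0 \<le> \<phi> x) \<longrightarrow>
       \<bar>p - 2\<bar> * total_variation \<Omega> (quad (mat_Im A) \<xi>) \<phi>
         \<le> 2 * sqrt (p - 1) * Re (quad (mat_Re A) \<xi> (\<lambda>x. complex_of_real (\<phi> x))))
      \<longleftrightarrow> (\<forall>\<phi>. (\<lambda>x. complex_of_real (\<phi> x)) \<in> C0 \<Omega> \<and> (\<forall>x. 0 \<le> \<phi> x) \<longrightarrow>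
      \<bar>p - 2\<bar> * \<bar>If \<xi> \<phi>\<bar> \<le> 2 * sqrt (p - 1) * Rf \<xi> \<phi>)"
      unfolding quad_Im_of_real norm_of_real \<nu>_def quad_Re_of_real Rf_def If_def by simp
  qed
  moreover have "Lp_dissipative \<Omega> p (sesq_form A) \<longleftrightarrow> ?D"
  proof (cases "p \<ge> 2")
    case True
    have "Lp_dissipative \<Omega> p (sesq_form A) \<longleftrightarrow> algebraic_condition \<Omega> p A"
      using True dissipative_of_algebraic_condition[OF assms(1) True assms(3) sym]
        algebraic_condition_of_dissipative[OF assms(1) True assms(3)]
      by (auto simp: Lp_dissipative_def)
    then show ?thesis using True by (simp add: algebraic_condition_def Rf_def If_def)
  next
    case False
    define q where "q = p / (p - 1)"
    have q: "q \<ge> 2" using False assms(2) by (simp add: q_def field_simps)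
    define B where "B = (\<chi> h k. meas_cnj (A $ k $ h))"
    have B: "B $ h $ k \<in> C0_dual \<Omega>" for h k
      by (simp add: B_def dual_meas_cnj[OF assms(1,3)])
    have B_val: "(B $ h $ k) (\<lambda>x. complex_of_real (\<phi> x)) = cnj ((A $ k $ h) (\<lambda>x. complex_of_real (\<phi> x)))" for h k \<phi>
      by (simp add: B_def meas_cnj_def)
    have symB: "Im ((B $ h $ k) (\<lambda>x. complex_of_real (\<phi> x))) = Im ((B $ k $ h) (\<lambda>x. complex_of_real (\<phi> x)))"
      if "(\<lambda>x. complex_of_real (\<phi> x)) \<in> C0 \<Omega>" for h k \<phi>
      using sym[OF that, of k h] by (simp add: B_val)
    \<comment> \<open>Transposition does not change a quadratic form, and conjugation only flips the
      sign of the imaginary one, which the modulus ignores.\<close>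
    have RB: "(\<Sum>h\<in>UNIV. \<Sum>k\<in>UNIV. \<xi> $ k * \<xi> $ h * Re ((B $ h $ k) (\<lambda>x. complex_of_real (\<phi> x)))) = Rf \<xi> \<phi>"
      and IB: "(\<Sum>h\<in>UNIV. \<Sum>k\<in>UNIV. \<xi> $ k * \<xi> $ h * Im ((B $ h $ k) (\<lambda>x. complex_of_real (\<phi> x)))) = - If \<xi> \<phi>" for \<xi> \<phi>
      unfolding Rf_def If_def by (subst sum.swap, simp add: B_val mult_ac sum_negf)+
    have "Lp_dissipative \<Omega> p (sesq_form A) \<longleftrightarrow> (\<forall>u\<in>C01 \<Omega>. 0 \<le> Re (sesq_form B u (pow_mult q u)))"
      using False by (simp add: Lp_dissipative_def B_def sesq_form_adjoint q_def)
    also have "\<dots> \<longleftrightarrow> algebraic_condition \<Omega> q B"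
      using dissipative_of_algebraic_condition[OF assms(1) q B symB]
        algebraic_condition_of_dissipative[OF assms(1) q B] by auto
    also have "\<dots> \<longleftrightarrow> ?D"
      unfolding algebraic_condition_def RB IB abs_minus_cancel
      using exponent_rescaling[OF assms(2)] False by (simp add: q_def)
    finally show ?thesis .
  qed
  ultimately show ?thesis by simp
qed

end
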